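(* There exist a finite alphabet $\Sigma$ and a positive regular expression $C$ over $\Sigma$ such that the decision problem "Given a regular expression $R$ over $\Sigma$ such that $(R,C)$ is plural, does an $(R,C)$-crossword exist?" is m-equivalent to the Halting Problem (and hence undecidable).
   Context: Regular expressions are built from letters, $\varepsilon$, union, concatenation and Kleene star; a string matches $E$ if it lies in $L(E)$. For an alphabet $\Sigma$, a $\Sigma$-crossword is a nonempty $m\times n$ array ($m,n\ge1$) of symbols of $\Sigma$; an $(R,C)$-crossword is a $\Sigma$-crossword whose every row (read left to right) matches $R$ and every column (read top to bottom) matches $C$. A regular expression is positive if the empty string does not match it. A pair $(R,C)$ is plural if $R$ and $C$ are both positive and every $(R,C)$-crossword has at least two rows and at least two columns. Two decision problems are m-equivalent if each is many-one reducible to the other via a total computable function. The Halting Problem is the set of (encodings of) pairs $(M,w)$ of a Turing machine $M$ and an input $w$ such that $M$ halts on $w$. *)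

theory Defs
  imports Main "HOL-Library.Nat_Bijection"
begin

section \<open>Regular expressions and crosswords\<close>

text \<open>There is deliberately no expression for the empty language: expressions are built from
  letters, the empty word, union, concatenation and star only.\<close>

datatype (letters: 'a) rexp =
    Eps
  | Letter 'a
  | Plus "'a rexp" "'a rexp"
  | Times "'a rexp" "'a rexp"
  | Star "'a rexp"

primrec lang :: "'a rexp \<Rightarrow> 'a list set" where
  "lang Eps = {[]}"
| "lang (Letter a) = {[a]}"
| "lang (Plus r s) = lang r \<union> lang s"
| "lang (Times r s) = {u @ v | u v. u \<in> lang r \<and> v \<in> lang s}"
| "lang (Star r) = {concat ws | ws. set ws \<subseteq> lang r}"

definition positive :: "'a rexp \<Rightarrow> bool" where
  "positive r \<longleftrightarrow> [] \<notin> lang r"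

text \<open>An \<open>m \<times> n\<close> array is a function \<open>a\<close>, of which only the values \<open>a i j\<close> with row index
  \<open>i < m\<close> and column index \<open>j < n\<close> are relevant.\<close>

definition crossword ::
    "'a set \<Rightarrow> 'a rexp \<Rightarrow> 'a rexp \<Rightarrow> nat \<Rightarrow> nat \<Rightarrow> (nat \<Rightarrow> nat \<Rightarrow> 'a) \<Rightarrow> bool" where
  "crossword \<Sigma> R C m n a \<longleftrightarrow>
     m \<ge> 1 \<and> n \<ge> 1 \<and>
     (\<forall>i<m. \<forall>j<n. a i j \<in> \<Sigma>) \<and>
     (\<forall>i<m. map (\<lambda>j. a i j) [0..<n] \<in> lang R) \<and>
     (\<forall>j<n. map (\<lambda>i. a i j) [0..<m] \<in> lang C)"

definition plural :: "'a set \<Rightarrow> 'a rexp \<Rightarrow> 'a rexp \<Rightarrow> bool" where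
  "plural \<Sigma> R C \<longleftrightarrow>
     positive R \<and> positive C \<and>
     (\<forall>m n a. crossword \<Sigma> R C m n a \<longrightarrow> m \<ge> 2 \<and> n \<ge> 2)"


section \<open>Computable functions\<close>

text \<open>Partial recursive functions of varying arity. Primitive recursion is on the first
  argument, and minimization also ranges over the first argument of its operand.\<close>

datatype recf =
    Zero
  | Succ
  | Proj nat
  | Comp recf "recf list"
  | PrimRec recf recf
  | Mu recf

text \<open>\<open>computes p xs y\<close>: the function described by \<open>p\<close> is defined at \<open>xs\<close>, with value \<open>y\<close>.\<close>

inductive computes :: "recf \<Rightarrow> nat list \<Rightarrow> nat \<Rightarrow> bool" where
  Zero: "computes Zero xs 0"
| Succ: "computes Succ [x] (Suc x)"
| Proj: "i < length xs \<Longrightarrow> computes (Proj i) xs (xs ! i)"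
| Comp: "list_all2 (\<lambda>g y. computes g xs y) gs ys \<Longrightarrow> computes f ys z \<Longrightarrow>
           computes (Comp f gs) xs z"
| PrimRec_0: "computes f xs y \<Longrightarrow> computes (PrimRec f g) (0 # xs) y"
| PrimRec_Suc: "computes (PrimRec f g) (n # xs) r \<Longrightarrow> computes g (n # r # xs) y \<Longrightarrow>
           computes (PrimRec f g) (Suc n # xs) y"
| Mu: "computes f (n # xs) 0 \<Longrightarrow> (\<forall>i<n. \<exists>y. computes f (i # xs) (Suc y)) \<Longrightarrow>
           computes (Mu f) xs n"

inductive_cases computes_elims:
  "computes Zero xs y" "computes Succ xs y" "computes (Proj i) xs y" "computes (Comp f gs) xs y"
  "computes (PrimRec f g) (0 # xs) y" "computes (PrimRec f g) (Suc n # xs) y" "computes (Mu f) xs y"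

lemma computes_deterministic: "computes p xs y \<Longrightarrow> computes p xs z \<Longrightarrow> y = z"
proof (induction arbitrary: z rule: computes.induct)
  case (Comp xs gs ys f w)
  from Comp.prems obtain ys' where
    ys': "list_all2 (\<lambda>g y. computes g xs y) gs ys'" "computes f ys' z"
    by (rule computes_elims)
  have "ys = ys'"
    using Comp.IH(1) ys'(1) by (auto simp: list_all2_conv_all_nth intro!: nth_equalityI)
  then show ?case
    using Comp.IH(2) ys'(2) by blast
next
  case (PrimRec_Suc f g n xs r y)
  from PrimRec_Suc.prems obtain r' where
    "computes (PrimRec f g) (n # xs) r'" "computes g (n # r' # xs) z"
    by (rule computes_elims)
  then show ?case
    using PrimRec_Suc.IH by blast
next
  case (Mu f n xs)
  from Mu.prems have z: "computes f (z # xs) 0" "\<forall>i<z. \<exists>y. computes f (i # xs) (Suc y)"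
    by (rule computes_elims, simp)+
  show ?case
  proof (cases n z rule: linorder_cases)
    case less
    then show ?thesis using z(2) Mu.IH(1) by blast
  next
    case greater
    then show ?thesis using z(1) Mu.IH(2) by blast
  qed
qed (erule computes_elims; simp)+

definition total_computable :: "(nat \<Rightarrow> nat) \<Rightarrow> bool" where
  "total_computable f \<longleftrightarrow> (\<exists>p. \<forall>x. computes p [x] (f x))"


section \<open>Decision problems and many-one reducibility\<close>

text \<open>A decision problem consists of its (encoded) instances and of those instances whose
  answer is yes; a problem of the form "given \<open>x\<close> such that \<open>P x\<close>, does \<open>Q x\<close> hold?" has
  instances \<open>{x. P x}\<close>. A set of numbers is the problem all of whose inputs are instances.\<close>

datatype decision_problem =
  Problem (instances: "nat set") (yes_instances: "nat set")

definition many_one_reducible :: "decision_problem \<Rightarrow> decision_problem \<Rightarrow> bool" where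
  "many_one_reducible A B \<longleftrightarrow>
     (\<exists>f. total_computable f \<and>
        (\<forall>x \<in> instances A. f x \<in> instances B \<and>
           (x \<in> yes_instances A \<longleftrightarrow> f x \<in> yes_instances B)))"

definition m_equivalent :: "decision_problem \<Rightarrow> decision_problem \<Rightarrow> bool" where
  "m_equivalent A B \<longleftrightarrow> many_one_reducible A B \<and> many_one_reducible B A"

text \<open>A decision procedure has to terminate, with the correct answer, on the instances only.\<close>

definition decidable :: "decision_problem \<Rightarrow> bool" where
  "decidable A \<longleftrightarrow>
     (\<exists>p. \<forall>x \<in> instances A. computes p [x] (if x \<in> yes_instances A then 1 else 0))"


section \<open>Turing machines and the Halting Problem\<close>

text \<open>Deterministic machines with one two-way infinite tape. States and tape symbols are natural
  numbers; \<open>0\<close> is the initial state and also the blank symbol. A machine is a finite transition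
  table, in which the first entry for a pair (state, scanned symbol) is the valid one. The machine
  halts when there is no entry.\<close>

datatype move = Move_Left | Move_Right

type_synonym tm = "((nat \<times> nat) \<times> (nat \<times> nat \<times> move)) list"

text \<open>State, head position and tape contents.\<close>

type_synonym config = "nat \<times> int \<times> (int \<Rightarrow> nat)"

primrec offset :: "move \<Rightarrow> int" where
  "offset Move_Left = - 1"
| "offset Move_Right = 1"

fun tm_step :: "tm \<Rightarrow> config \<Rightarrow> config option" where
  "tm_step M (q, h, t) =
     (case map_of M (q, t h) of
        None \<Rightarrow> None
      | Some (q', b, d) \<Rightarrow> Some (q', h + offset d, t(h := b)))"

definition initial_config :: "nat list \<Rightarrow> config" where
  "initial_config w =
     (0, 0, \<lambda>i. if 0 \<le> i \<and> i < int (length w) then w ! nat i else 0)"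

definition halts_on :: "tm \<Rightarrow> nat list \<Rightarrow> bool" where
  "halts_on M w \<longleftrightarrow>
     (\<exists>c. (\<lambda>c c'. tm_step M c = Some c')\<^sup>*\<^sup>* (initial_config w) c \<and> tm_step M c = None)"

primrec move_code :: "move \<Rightarrow> nat" where
  "move_code Move_Left = 0"
| "move_code Move_Right = 1"

fun entry_code :: "(nat \<times> nat) \<times> (nat \<times> nat \<times> move) \<Rightarrow> nat" where
  "entry_code ((q, a), (q', b, d)) =
     prod_encode (prod_encode (q, a), prod_encode (q', prod_encode (b, move_code d)))"

definition tm_code :: "tm \<Rightarrow> nat" where
  "tm_code M = list_encode (map entry_code M)"

lemma inj_tm_code: "inj tm_code"
proof -
  have move: "move_code d = move_code d' \<longleftrightarrow> d = d'" for d d'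
    by (cases d; cases d') auto
  have "inj entry_code"
    by (rule injI) (auto simp: move elim!: entry_code.elims)
  then show ?thesis
    by (intro injI) (simp add: tm_code_def list_encode_eq inj_map_eq_map)
qed

text \<open>Input words do not contain the blank symbol.\<close>

definition halting_problem :: decision_problem where
  "halting_problem =
     Problem UNIV {prod_encode (tm_code M, list_encode w) | M w. 0 \<notin> set w \<and> halts_on M w}"


section \<open>The crossword problem for a fixed column expression\<close>

primrec rexp_code :: "nat rexp \<Rightarrow> nat" where
  "rexp_code Eps = prod_encode (0, 0)"
| "rexp_code (Letter a) = prod_encode (1, a)"
| "rexp_code (Plus r s) = prod_encode (2, prod_encode (rexp_code r, rexp_code s))"
| "rexp_code (Times r s) = prod_encode (3, prod_encode (rexp_code r, rexp_code s))"
| "rexp_code (Star r) = prod_encode (4, rexp_code r)"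

lemma inj_rexp_code: "inj rexp_code"
proof (rule injI)
  show "r = s" if "rexp_code r = rexp_code s" for r s
    using that by (induction r arbitrary: s) (case_tac s; auto)+
qed

definition crossword_problem :: "nat set \<Rightarrow> nat rexp \<Rightarrow> decision_problem" where
  "crossword_problem \<Sigma> C =
     Problem {rexp_code R | R. letters R \<subseteq> \<Sigma> \<and> plural \<Sigma> R C}
             {rexp_code R | R. letters R \<subseteq> \<Sigma> \<and> plural \<Sigma> R C \<and> (\<exists>m n a. crossword \<Sigma> R C m n a)}"

end

theory Submission
  imports "HOL-Library.Countable" Defs
begin

text \<open>The letter coding the pair \<open>(u, v)\<close> in row \<open>i\<close> of a crossword says that step \<open>i\<close> turns the
  content \<open>u\<close> of a tape cell into \<open>v\<close>. The fixed column expression only says that consecutive letters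
  of a column fit together, and that the first and the last row are special. The row expression
  describes a single step of a fixed Turing machine, which changes at most two neighbouring cells; the
  first row writes the initial configuration, and the last row is possible only once the machine has
  halted. Only the first row depends on the input, so a machine that halts on \<open>x\<close> iff \<open>x\<close> is in the
  Halting Problem yields the reduction to crosswords.

  Such a machine, and the reduction in the other direction, are obtained by compiling semidecision
  procedures: recursive functions are translated to programs over finitely many counters, which a
  Turing machine stores on the parallel tracks of its tape. By the same translation, a decision
  procedure for the Halting Problem would give a machine halting on the number \<open>x\<close> iff the machine
  with code \<open>x\<close> does not.\<close>

section \<open>Computable functions and semidecidable predicates\<close>

text \<open>All rows of an array have the same length, and the space that a computation takes is not
  known in advance. The initial row guesses it, by any number of blanks on both sides of the input.
  The ends of a column are the contents \<open>0\<close> and \<open>1\<close>, which never stand on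
  a tape. Only the initial row reads \<open>0\<close>, only a row at a halting configuration writes
  \<open>1\<close>, and no row contains the letter for \<open>(0, 1)\<close>. Hence every crossword
  has a second row. The head cell and the blank that must follow the input give a second column, so
  every instance produced is plural. In the other direction plurality is a promise that is never
  tested, because a reduction is judged on instances only. The input is unary because the row
  expression is computed from \<open>x\<close> while machine, alphabet and column expression stay
  fixed. A unary input is also literally the track of counter \<open>0\<close> on the simulating
  tape. The machine must run forever when the search for a witness fails. So the simulation has to
  preserve divergence, not only results.\<close>

definition rec_fun :: "nat \<Rightarrow> (nat list \<Rightarrow> nat) \<Rightarrow> bool" where
  "rec_fun k f \<longleftrightarrow> (\<exists>p. \<forall>xs. length xs = k \<longrightarrow> computes p xs (f xs))"

lemma rec_fun_proj: "i < k \<Longrightarrow> rec_fun k (\<lambda>xs. xs ! i)"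
  unfolding rec_fun_def by (metis computes.Proj)

lemma rec_fun_proj_drop: "i + 2 < k \<Longrightarrow> rec_fun k (\<lambda>xs. drop 2 xs ! i)"
  using rec_fun_proj[of "2 + i" k] unfolding rec_fun_def by (auto simp: add.commute)

lemma rec_fun_comp1:
  assumes "rec_fun 1 (\<lambda>xs. F (xs ! 0))" "rec_fun k f"
  shows "rec_fun k (\<lambda>xs. F (f xs))"
proof -
  from assms obtain p q where
    p: "\<And>xs. length xs = 1 \<Longrightarrow> computes p xs (F (xs ! 0))" and
    q: "\<And>xs. length xs = k \<Longrightarrow> computes q xs (f xs)"
    unfolding rec_fun_def by blast
  have "computes (Comp p [q]) xs (F (f xs))" if "length xs = k" for xs
    using p[of "[f xs]"] q[OF that] by (auto intro!: computes.Comp[of _ _ "[f xs]"])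
  then show ?thesis unfolding rec_fun_def by blast
qed

lemma rec_fun_comp2:
  assumes "rec_fun 2 (\<lambda>xs. F (xs ! 0) (xs ! 1))" "rec_fun k f" "rec_fun k g"
  shows "rec_fun k (\<lambda>xs. F (f xs) (g xs))"
proof -
  from assms obtain p q r where
    p: "\<And>xs. length xs = 2 \<Longrightarrow> computes p xs (F (xs ! 0) (xs ! 1))" and
    q: "\<And>xs. length xs = k \<Longrightarrow> computes q xs (f xs)" and
    r: "\<And>xs. length xs = k \<Longrightarrow> computes r xs (g xs)"
    unfolding rec_fun_def by blast
  have "computes (Comp p [q, r]) xs (F (f xs) (g xs))" if "length xs = k" for xs
    using p[of "[f xs, g xs]"] q[OF that] r[OF that]
    by (auto intro!: computes.Comp[of _ _ "[f xs, g xs]"])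
  then show ?thesis unfolding rec_fun_def by blast
qed

lemma rec_fun_0: "rec_fun k (\<lambda>xs. 0)"
  unfolding rec_fun_def by (metis computes.Zero)

lemma rec_fun_Suc: "rec_fun k f \<Longrightarrow> rec_fun k (\<lambda>xs. Suc (f xs))"
proof (rule rec_fun_comp1[where F = "Suc"])
  show "rec_fun 1 (\<lambda>xs. Suc (xs ! 0))"
    unfolding rec_fun_def
    by (rule exI[of _ Succ]) (auto simp: length_Suc_conv intro: computes.Succ)
qed

text \<open>\<open>PrimRec\<close> recurses on its first argument and hands the others on. Composing
  it with \<open>m\<close> and all projections allows any computable number of rounds, with the
  whole argument list as parameter.\<close>

lemma rec_fun_rec:
  assumes "rec_fun k m" "rec_fun k g"
    and "rec_fun (Suc (Suc k)) (\<lambda>ys. h (ys ! 0) (ys ! 1) (drop 2 ys))"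
  shows "rec_fun k (\<lambda>xs. rec_nat (g xs) (\<lambda>n r. h n r xs) (m xs))"
proof -
  from assms obtain p q s where
    p: "\<And>xs. length xs = k \<Longrightarrow> computes p xs (m xs)" and
    q: "\<And>xs. length xs = k \<Longrightarrow> computes q xs (g xs)" and
    s: "\<And>ys. length ys = Suc (Suc k) \<Longrightarrow> computes s ys (h (ys ! 0) (ys ! 1) (drop 2 ys))"
    unfolding rec_fun_def by blast
  have "computes (Comp (PrimRec q s) (p # map Proj [0..<k])) xs
          (rec_nat (g xs) (\<lambda>n r. h n r xs) (m xs))" if xs: "length xs = k" for xs
  proof (rule computes.Comp)
    show "list_all2 (\<lambda>g y. computes g xs y) (p # map Proj [0..<k]) (m xs # xs)"
      using p[OF xs] xs
      by (auto simp: list_all2_conv_all_nth nth_Cons split: nat.splits intro: computes.Proj)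
    have "computes (PrimRec q s) (n # xs) (rec_nat (g xs) (\<lambda>n r. h n r xs) n)" for n
    proof (induction n)
      case 0
      then show ?case using q[OF xs] by (simp add: computes.PrimRec_0)
    next
      case (Suc n)
      from s[of "n # rec_nat (g xs) (\<lambda>n r. h n r xs) n # xs"] xs show ?case
        by (auto intro: computes.PrimRec_Suc[OF Suc])
    qed
    then show "computes (PrimRec q s) (m xs # xs) (rec_nat (g xs) (\<lambda>n r. h n r xs) (m xs))" .
  qed
  then show ?thesis unfolding rec_fun_def by blast
qed

lemma rec_fun_add: "rec_fun k f \<Longrightarrow> rec_fun k g \<Longrightarrow> rec_fun k (\<lambda>xs. f xs + g xs)"
proof (rule rec_fun_comp2[where F = "(+)"])
  have "rec_fun 2 (\<lambda>xs. rec_nat (xs ! 1) (\<lambda>n r. Suc r) (xs ! 0))"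
    by (rule rec_fun_rec) (intro rec_fun_proj rec_fun_Suc; simp)+
  moreover have "rec_nat b (\<lambda>n r. Suc r) a = a + b" for a b :: nat
    by (induction a) auto
  ultimately show "rec_fun 2 (\<lambda>xs. xs ! 0 + xs ! 1)" by simp
qed

lemma rec_fun_pred: "rec_fun k f \<Longrightarrow> rec_fun k (\<lambda>xs. f xs - 1)"
proof (rule rec_fun_comp1[where F = "\<lambda>a. a - 1"])
  have "rec_fun 1 (\<lambda>xs. rec_nat 0 (\<lambda>n r. n) (xs ! 0))"
    by (rule rec_fun_rec) (intro rec_fun_proj rec_fun_0; simp)+
  moreover have "rec_nat 0 (\<lambda>n r. n) a = a - 1" for a :: nat
    by (cases a) auto
  ultimately show "rec_fun 1 (\<lambda>xs. xs ! 0 - 1)" by simp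
qed

lemma rec_fun_diff: "rec_fun k f \<Longrightarrow> rec_fun k g \<Longrightarrow> rec_fun k (\<lambda>xs. f xs - g xs)"
proof (rule rec_fun_comp2[where F = "(-)"])
  have "rec_fun 2 (\<lambda>xs. rec_nat (xs ! 0) (\<lambda>n r. r - 1) (xs ! 1))"
    by (rule rec_fun_rec) (intro rec_fun_proj rec_fun_pred; simp)+
  moreover have "rec_nat a (\<lambda>n r. r - 1) b = a - b" for a b :: nat
    by (induction b) auto
  ultimately show "rec_fun 2 (\<lambda>xs. xs ! 0 - xs ! 1)" by simp
qed

lemma rec_fun_triangle: "rec_fun k f \<Longrightarrow> rec_fun k (\<lambda>xs. triangle (f xs))"
proof (rule rec_fun_comp1[where F = "triangle"])
  have "rec_fun 1 (\<lambda>xs. rec_nat 0 (\<lambda>n r. r + Suc n) (xs ! 0))"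
    by (rule rec_fun_rec) (intro rec_fun_proj rec_fun_0 rec_fun_add rec_fun_Suc; simp)+
  moreover have "rec_nat 0 (\<lambda>n r. r + Suc n) a = triangle a" for a :: nat
    by (induction a) auto
  ultimately show "rec_fun 1 (\<lambda>xs. triangle (xs ! 0))" by simp
qed

section \<open>The pairing function and its inverse\<close>

definition p1 :: "nat \<Rightarrow> nat" where "p1 z = fst (prod_decode z)"
definition p2 :: "nat \<Rightarrow> nat" where "p2 z = snd (prod_decode z)"

lemma p1_prod_encode [simp]: "p1 (prod_encode (a, b)) = a"
  and p2_prod_encode [simp]: "p2 (prod_encode (a, b)) = b"
  by (simp_all add: p1_def p2_def)

lemma prod_encode_p1_p2 [simp]: "prod_encode (p1 z, p2 z) = z"
  by (simp add: p1_def p2_def)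

text \<open>The largest \<open>r\<close> with \<open>triangle r \<le> n\<close>. With truncated
  subtraction, \<open>1 - (a - b)\<close> is \<open>1\<close> if \<open>a \<le> b\<close> and
  \<open>0\<close> otherwise, so the value grows exactly when the next triangular number is
  reached.\<close>

definition triangle_root :: "nat \<Rightarrow> nat" where
  "triangle_root = rec_nat 0 (\<lambda>n r. r + (1 - (triangle (Suc r) - Suc n)))"

lemma triangle_root_bounds: "triangle (triangle_root n) \<le> n \<and> n < triangle (Suc (triangle_root n))"
proof (induction n)
  case (Suc n)
  then show ?case
    by (cases "triangle (Suc (triangle_root n)) \<le> Suc n") (auto simp: triangle_root_def)
qed (simp add: triangle_root_def)

text \<open>\<open>prod_encode (a, b)\<close> is \<open>triangle (a + b) + a\<close>, which lies
  before the next triangular number. The root thus recovers \<open>a + b\<close>, and both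
  projections become arithmetic.\<close>

lemma triangle_root_prod_encode: "triangle_root (prod_encode (a, b)) = a + b"
proof -
  have mono: "triangle m \<le> triangle n" if "m \<le> n" for m n
    using that by (induction n rule: dec_induct) auto
  let ?z = "prod_encode (a, b)"
  have "triangle (a + b) \<le> ?z" "?z < triangle (Suc (a + b))"
    by (auto simp: prod_encode_def)
  with triangle_root_bounds[of ?z] mono show ?thesis
    by (meson le_less_trans not_less_eq_eq not_less le_antisym)
qed

lemma p1_eq: "p1 z = z - triangle (triangle_root z)"
  using triangle_root_prod_encode[of "p1 z" "p2 z"] prod_encode_p1_p2[of z]
  unfolding prod_encode_def by simp

lemma p2_eq: "p2 z = triangle_root z - p1 z"
  using triangle_root_prod_encode[of "p1 z" "p2 z"] by simp

lemma rec_fun_triangle_root: "rec_fun k f \<Longrightarrow> rec_fun k (\<lambda>xs. triangle_root (f xs))"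
proof (rule rec_fun_comp1[where F = "triangle_root"])
  show "rec_fun 1 (\<lambda>xs. triangle_root (xs ! 0))"
    unfolding triangle_root_def One_nat_def
    by (rule rec_fun_rec)
      (intro rec_fun_proj rec_fun_0 rec_fun_add rec_fun_Suc rec_fun_diff rec_fun_triangle; simp)+
qed

lemma rec_fun_p1: "rec_fun k f \<Longrightarrow> rec_fun k (\<lambda>xs. p1 (f xs))"
  unfolding p1_eq by (intro rec_fun_diff rec_fun_triangle rec_fun_triangle_root)

lemma rec_fun_p2: "rec_fun k f \<Longrightarrow> rec_fun k (\<lambda>xs. p2 (f xs))"
  unfolding p2_eq by (intro rec_fun_diff rec_fun_p1 rec_fun_triangle_root)

lemma rec_fun_prod_encode:
  "rec_fun k f \<Longrightarrow> rec_fun k g \<Longrightarrow> rec_fun k (\<lambda>xs. prod_encode (f xs, g xs))"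
  unfolding prod_encode_def by (simp add: rec_fun_add rec_fun_triangle)

section \<open>Unary computable functions and computable predicates\<close>

named_theorems computable_intros

text \<open>From here on several arguments are packed with \<open>prod_encode\<close>. With the
  arity gone, closure properties become introduction rules that follow the shape of a term.\<close>

lemma total_computable_iff: "total_computable f \<longleftrightarrow> rec_fun 1 (\<lambda>xs. f (xs ! 0))"
proof -
  have "(\<forall>xs. length xs = 1 \<longrightarrow> computes p xs (f (xs ! 0))) \<longleftrightarrow> (\<forall>x. computes p [x] (f x))" for p
    by (metis (no_types) One_nat_def length_0_conv length_Cons length_Suc_conv nth_Cons_0)
  then show ?thesis unfolding total_computable_def rec_fun_def by simp
qed

lemma total_computable_id [computable_intros]: "total_computable (\<lambda>x. x)"
  unfolding total_computable_iff by (simp add: rec_fun_proj)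

lemma total_computable_comp:
  "total_computable F \<Longrightarrow> total_computable f \<Longrightarrow> total_computable (\<lambda>x. F (f x))"
  unfolding total_computable_iff by (rule rec_fun_comp1)

lemma total_computable_const [computable_intros]: "total_computable (\<lambda>x. c)"
proof (induction c)
  case (Suc c)
  then show ?case unfolding total_computable_iff by (rule rec_fun_Suc)
qed (simp add: total_computable_iff rec_fun_0)

lemma total_computable_basic [computable_intros]:
  assumes "total_computable f"
  shows "total_computable (\<lambda>x. Suc (f x))" "total_computable (\<lambda>x. p1 (f x))"
    "total_computable (\<lambda>x. p2 (f x))"
  using assms by (simp_all add: total_computable_iff rec_fun_Suc rec_fun_p1 rec_fun_p2)

lemma total_computable_basic2 [computable_intros]:
  assumes "total_computable f" "total_computable g"
  shows "total_computable (\<lambda>x. f x + g x)" "total_computable (\<lambda>x. f x - g x)"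
    "total_computable (\<lambda>x. prod_encode (f x, g x))"
  using assms
  by (simp_all add: total_computable_iff rec_fun_add rec_fun_diff rec_fun_prod_encode)

lemma total_computable_comp2:
  assumes "total_computable (\<lambda>z. F (p1 z) (p2 z))" "total_computable f" "total_computable g"
  shows "total_computable (\<lambda>x. F (f x) (g x))"
  using total_computable_comp[OF assms(1) total_computable_basic2(3)[OF assms(2,3)]]
  by (simp only: p1_prod_encode p2_prod_encode)

lemma total_computable_rec [computable_intros]:
  assumes "total_computable m" "total_computable g"
    and "total_computable (\<lambda>z. h (p1 z) (p1 (p2 z)) (p2 (p2 z)))"
  shows "total_computable (\<lambda>x. rec_nat (g x) (\<lambda>n r. h n r x) (m x))"
proof -
  have "rec_fun 3 (\<lambda>ys. (\<lambda>z. h (p1 z) (p1 (p2 z)) (p2 (p2 z)))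
          (prod_encode (ys ! 0, prod_encode (ys ! 1, drop 2 ys ! 0))))"
    by (rule rec_fun_comp1[OF assms(3)[unfolded total_computable_iff]])
      (intro rec_fun_prod_encode rec_fun_proj rec_fun_proj_drop; simp)
  then have "rec_fun (Suc (Suc 1)) (\<lambda>ys. h (ys ! 0) (ys ! 1) (drop 2 ys ! 0))"
    by (simp add: numeral_3_eq_3)
  with assms(1,2) show ?thesis
    unfolding total_computable_iff by (rule rec_fun_rec[where h = "\<lambda>n r xs. h n r (xs ! 0)"])
qed

definition computable_pred :: "(nat \<Rightarrow> bool) \<Rightarrow> bool" where
  "computable_pred P \<longleftrightarrow> total_computable (\<lambda>x. of_bool (P x))"

lemma total_computable_if [computable_intros]:
  assumes "computable_pred P" "total_computable f" "total_computable g"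
  shows "total_computable (\<lambda>x. if P x then f x else g x)"
proof -
  \<comment> \<open>A conditional is a recursion of at most one round, the number of rounds being
    the truth value of \<open>P x\<close>.\<close>
  have "total_computable (\<lambda>x. rec_nat (g x) (\<lambda>n r. f x) (of_bool (P x)))"
    by (rule total_computable_rec[OF assms(1)[unfolded computable_pred_def] assms(3)])
      (rule total_computable_comp[OF assms(2)], intro computable_intros)
  moreover have "rec_nat (g x) (\<lambda>n r. f x) (of_bool (P x)) = (if P x then f x else g x)" for x
    by simp
  ultimately show ?thesis by simp
qed

lemma computable_pred_comp:
  "computable_pred P \<Longrightarrow> total_computable f \<Longrightarrow> computable_pred (\<lambda>x. P (f x))"
  unfolding computable_pred_def by (rule total_computable_comp)

lemma computable_pred_comp2:
  assumes "computable_pred (\<lambda>z. P (p1 z) (p2 z))" "total_computable f" "total_computable g"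
  shows "computable_pred (\<lambda>x. P (f x) (g x))"
  using assms unfolding computable_pred_def by (rule total_computable_comp2)

lemma computable_pred_not [computable_intros]:
  assumes "computable_pred P"
  shows "computable_pred (\<lambda>x. \<not> P x)"
proof -
  have "total_computable (\<lambda>x. 1 - of_bool (P x))"
    using assms unfolding computable_pred_def by (intro computable_intros)
  moreover have "1 - of_bool (P x) = (of_bool (\<not> P x) :: nat)" for x by simp
  ultimately show ?thesis by (simp add: computable_pred_def)
qed

lemma computable_pred_connectives [computable_intros]:
  assumes "computable_pred P" "computable_pred Q"
  shows "computable_pred (\<lambda>x. P x \<and> Q x)" "computable_pred (\<lambda>x. P x \<or> Q x)"
    "computable_pred (\<lambda>x. P x \<longrightarrow> Q x)"
proof -
  note Q = assms(2)[unfolded computable_pred_def]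
  have eqs: "of_bool (P x \<and> Q x) = (if P x then of_bool (Q x) else 0)"
    "of_bool (P x \<or> Q x) = (if P x then 1 else of_bool (Q x))"
    "of_bool (P x \<longrightarrow> Q x) = (if P x then of_bool (Q x) else 1)" for x by simp_all
  show "computable_pred (\<lambda>x. P x \<and> Q x)" "computable_pred (\<lambda>x. P x \<or> Q x)"
    "computable_pred (\<lambda>x. P x \<longrightarrow> Q x)"
    unfolding computable_pred_def eqs
    by (intro total_computable_if assms(1) Q total_computable_const)+
qed

lemma computable_pred_compare [computable_intros]:
  assumes "total_computable f" "total_computable g"
  shows "computable_pred (\<lambda>x. f x \<le> g x)" "computable_pred (\<lambda>x. f x < g x)"
    "computable_pred (\<lambda>x. f x = g x)"
proof -
  have le: "computable_pred (\<lambda>x. f x \<le> g x)"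
    if "total_computable f" "total_computable g" for f g
  proof -
    have "total_computable (\<lambda>x. 1 - (f x - g x))"
      using that by (intro computable_intros)
    moreover have "1 - (f x - g x) = of_bool (f x \<le> g x)" for x by auto
    ultimately show ?thesis by (simp add: computable_pred_def)
  qed
  show "computable_pred (\<lambda>x. f x \<le> g x)" using assms by (rule le)
  show "computable_pred (\<lambda>x. f x < g x)"
    using computable_pred_not[OF le[OF assms(2,1)]] by (simp add: not_le)
  show "computable_pred (\<lambda>x. f x = g x)"
    using computable_pred_connectives(1)[OF le[OF assms] le[OF assms(2,1)]]
    by (simp add: eq_iff)
qed

lemma computable_pred_all_less [computable_intros]:
  assumes "total_computable m" "computable_pred (\<lambda>z. P (p1 z) (p2 z))"
  shows "computable_pred (\<lambda>x. \<forall>i<m x. P i x)"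
proof -
  \<comment> \<open>The accumulator starts at \<open>1\<close> and stays \<open>0\<close> once some
    \<open>P n x\<close> has failed.\<close>
  have "total_computable (\<lambda>x. rec_nat (Suc 0) (\<lambda>n r. if P n x then r else 0) (m x))"
    by (intro computable_intros assms(1) computable_pred_comp2[OF assms(2)])
  moreover have "rec_nat (Suc 0) (\<lambda>n r. if P n x then r else 0) k = of_bool (\<forall>i<k. P i x)" for k x
    by (induction k) (auto simp: less_Suc_eq)
  ultimately show ?thesis unfolding computable_pred_def by simp
qed

text \<open>List codes are read through these total functions: as \<open>p1 0 = p2 0 = 0\<close>, the code \<open>0\<close> of
  the empty list behaves like an infinite list of zeros.\<close>

definition chd :: "nat \<Rightarrow> nat" where "chd l = p1 (l - 1)"
definition ctl :: "nat \<Rightarrow> nat" where "ctl l = p2 (l - 1)"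
definition ccons :: "nat \<Rightarrow> nat \<Rightarrow> nat" where "ccons a l = Suc (prod_encode (a, l))"
definition cdrop :: "nat \<Rightarrow> nat \<Rightarrow> nat" where "cdrop l = rec_nat l (\<lambda>_. ctl)"
definition cnth :: "nat \<Rightarrow> nat \<Rightarrow> nat" where "cnth l i = chd (cdrop l i)"

lemma chd_ccons [simp]: "chd (ccons a l) = a" and ctl_ccons [simp]: "ctl (ccons a l) = l"
  by (simp_all add: chd_def ctl_def ccons_def)

lemma p_0 [simp]: "p1 0 = 0" "p2 0 = 0"
proof -
  have "prod_encode (0, 0) = 0" by (simp add: prod_encode_def)
  then show "p1 0 = 0" "p2 0 = 0" by (metis p1_prod_encode, metis p2_prod_encode)
qed

lemma chd_0 [simp]: "chd 0 = 0" and ctl_0 [simp]: "ctl 0 = 0"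
  by (simp_all add: chd_def ctl_def)

lemma ccons_neq_0 [simp]: "ccons a l \<noteq> 0"
  by (simp add: ccons_def)

lemma list_encode_Cons [simp]: "list_encode (x # xs) = ccons x (list_encode xs)"
  by (simp add: ccons_def)

declare list_encode.simps(2) [simp del]

lemma ctl_list_encode: "ctl (list_encode xs) = list_encode (tl xs)"
  by (cases xs) auto

lemma cdrop_list_encode [simp]: "cdrop (list_encode xs) i = list_encode (drop i xs)"
  by (induction i) (auto simp: cdrop_def ctl_list_encode drop_Suc tl_drop)

lemma cnth_list_encode: "i < length xs \<Longrightarrow> cnth (list_encode xs) i = xs ! i"
  by (simp add: cnth_def flip: Cons_nth_drop_Suc)

lemma length_le_list_encode: "length xs \<le> list_encode xs"
proof (induction xs)
  case (Cons x xs)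
  then show ?case using le_prod_encode_2[of "list_encode xs" x] by (simp add: ccons_def)
qed simp

lemma list_encode_eq_0_iff [simp]: "list_encode xs = 0 \<longleftrightarrow> xs = []"
  by (cases xs) auto

lemma total_computable_list [computable_intros]:
  assumes "total_computable f"
  shows "total_computable (\<lambda>x. chd (f x))" "total_computable (\<lambda>x. ctl (f x))"
  unfolding chd_def ctl_def by (intro computable_intros assms)+

lemma total_computable_list2 [computable_intros]:
  assumes "total_computable f" "total_computable g"
  shows "total_computable (\<lambda>x. ccons (f x) (g x))" "total_computable (\<lambda>x. cdrop (f x) (g x))"
    "total_computable (\<lambda>x. cnth (f x) (g x))"
proof -
  show drop: "total_computable (\<lambda>x. cdrop (f x) (g x))"
    unfolding cdrop_def by (intro computable_intros assms)
  show "total_computable (\<lambda>x. ccons (f x) (g x))" "total_computable (\<lambda>x. cnth (f x) (g x))"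
    unfolding ccons_def cnth_def by (intro computable_intros assms drop)+
qed

section \<open>Semidecidable predicates and their closure properties\<close>

text \<open>The Sigma-1 normal form: an unbounded search for one number that passes a computable
  test. \<open>Mu\<close> will carry out this search.\<close>

definition semidecidable :: "(nat \<Rightarrow> bool) \<Rightarrow> bool" where
  "semidecidable P \<longleftrightarrow>
     (\<exists>Q. computable_pred Q \<and> (\<forall>x. P x \<longleftrightarrow> (\<exists>n. Q (prod_encode (n, x)))))"

lemma semidecidable_computable_pred: "computable_pred P \<Longrightarrow> semidecidable P"
  unfolding semidecidable_def
  by (rule exI[of _ "\<lambda>z. P (p2 z)"])
    (simp add: computable_pred_def total_computable_comp[of "\<lambda>x. of_bool (P x)"] computable_intros)

lemma semidecidable_comp:
  assumes "semidecidable P" "total_computable f"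
  shows "semidecidable (\<lambda>x. P (f x))"
proof -
  from assms obtain Q where Q: "computable_pred Q" "\<And>x. P x \<longleftrightarrow> (\<exists>n. Q (prod_encode (n, x)))"
    unfolding semidecidable_def by blast
  show ?thesis unfolding semidecidable_def
  proof (intro exI conjI allI)
    show "computable_pred (\<lambda>z. Q (prod_encode (p1 z, f (p2 z))))"
      using Q(1) unfolding computable_pred_def
      by (rule total_computable_comp) (intro computable_intros total_computable_comp[OF assms(2)])
  qed (simp add: Q(2))
qed

lemma semidecidable_ex:
  assumes "semidecidable (\<lambda>z. P (p1 z) (p2 z))"
  shows "semidecidable (\<lambda>x. \<exists>y. P y x)"
proof -
  from assms obtain Q where Q: "computable_pred Q"
    "\<And>z. P (p1 z) (p2 z) \<longleftrightarrow> (\<exists>n. Q (prod_encode (n, z)))"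
    unfolding semidecidable_def by blast
  show ?thesis unfolding semidecidable_def
  proof (intro exI conjI allI)
    \<comment> \<open>The new witness is a pair of the witness for \<open>Q\<close> and the value of
      \<open>y\<close>, so one search covers both quantifiers.\<close>
    show "computable_pred (\<lambda>z. Q (prod_encode (p1 (p1 z), prod_encode (p2 (p1 z), p2 z))))"
      using Q(1) unfolding computable_pred_def
      by (rule total_computable_comp) (intro computable_intros)
    show "(\<exists>y. P y x) \<longleftrightarrow> (\<exists>n. Q (prod_encode (p1 (p1 (prod_encode (n, x))),
            prod_encode (p2 (p1 (prod_encode (n, x))), p2 (prod_encode (n, x))))))" for x
    proof -
      have P: "P y x \<longleftrightarrow> (\<exists>n. Q (prod_encode (n, prod_encode (y, x))))" for y
        using Q(2)[of "prod_encode (y, x)"] by simp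
      show ?thesis unfolding P p1_prod_encode p2_prod_encode
        by (metis p1_prod_encode p2_prod_encode)
    qed
  qed
qed

lemma semidecidable_conj:
  assumes "semidecidable P" "semidecidable Q"
  shows "semidecidable (\<lambda>x. P x \<and> Q x)"
proof -
  from assms obtain P' Q' where
    P: "computable_pred P'" "\<And>x. P x \<longleftrightarrow> (\<exists>n. P' (prod_encode (n, x)))" and
    Q: "computable_pred Q'" "\<And>x. Q x \<longleftrightarrow> (\<exists>n. Q' (prod_encode (n, x)))"
    unfolding semidecidable_def by blast
  have "semidecidable (\<lambda>x. \<exists>n m. P' (prod_encode (n, x)) \<and> Q' (prod_encode (m, x)))"
    by (intro semidecidable_ex semidecidable_computable_pred computable_intros
        computable_pred_comp[OF P(1)] computable_pred_comp[OF Q(1)])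
  then show ?thesis using P(2) Q(2) by simp
qed

text \<open>Bounded collection: a single list code \<open>c\<close> holds the witnesses for all
  \<open>i < m x\<close>, which moves the existential quantifier to the front.\<close>

lemma semidecidable_all_less:
  assumes "semidecidable (\<lambda>z. P (p1 z) (p2 z))" "total_computable m"
  shows "semidecidable (\<lambda>x. \<forall>i<m x. P i x)"
proof -
  from assms obtain Q where Q: "computable_pred Q"
    "\<And>z. P (p1 z) (p2 z) \<longleftrightarrow> (\<exists>n. Q (prod_encode (n, z)))"
    unfolding semidecidable_def by blast
  have P: "P i x \<longleftrightarrow> (\<exists>n. Q (prod_encode (n, prod_encode (i, x))))" for i x
    using Q(2)[of "prod_encode (i, x)"] by simp
  have "semidecidable (\<lambda>x. \<exists>c. \<forall>i<m x. Q (prod_encode (cnth c i, prod_encode (i, x))))"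
    by (intro semidecidable_ex semidecidable_computable_pred computable_intros
        total_computable_comp[OF assms(2)] computable_pred_comp[OF Q(1)])
  moreover have "(\<forall>i<m x. P i x) \<longleftrightarrow>
      (\<exists>c. \<forall>i<m x. Q (prod_encode (cnth c i, prod_encode (i, x))))" for x
  proof
    assume "\<forall>i<m x. P i x"
    then obtain f where "\<forall>i<m x. Q (prod_encode (f i, prod_encode (i, x)))"
      unfolding P by metis
    then show "\<exists>c. \<forall>i<m x. Q (prod_encode (cnth c i, prod_encode (i, x)))"
      by (intro exI[of _ "list_encode (map f [0..<m x])"]) (simp add: cnth_list_encode)
  qed (auto simp: P)
  ultimately show ?thesis by simp
qed

section \<open>Crosswords as computations of a Turing machine\<close>

text \<open>Edges are recorded rather than vertices: the letters of a column are the steps of one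
  cell, and the successive contents of the cell are the vertices.\<close>

primrec walk :: "nat \<Rightarrow> nat list \<Rightarrow> nat \<Rightarrow> nat list" where
  "walk i [] j = [prod_encode (i, j)]"
| "walk i (v # vs) j = prod_encode (i, v) # walk v vs j"

text \<open>Kleene's construction of an expression for the walks from \<open>i\<close> to \<open>j\<close>, in the complete graph,
  whose inner vertices are taken from a given list.\<close>

primrec chain :: "nat list \<Rightarrow> nat \<Rightarrow> nat \<Rightarrow> nat rexp" where
  "chain [] i j = Letter (prod_encode (i, j))"
| "chain (k # ks) i j =
     Plus (chain ks i j) (Times (chain ks i k) (Times (Star (chain ks k k)) (chain ks k j)))"

lemma walk_append: "walk i (us @ v # vs) j = walk i us v @ walk v vs j"
  by (induction us arbitrary: i) auto

lemma length_walk [simp]: "length (walk i vs j) = Suc (length vs)"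
  by (induction vs arbitrary: i) auto

lemma walk_nth: "n \<le> length vs \<Longrightarrow> walk i vs j ! n = prod_encode ((i # vs) ! n, (vs @ [j]) ! n)"
proof (induction vs arbitrary: i n)
  case (Cons v vs)
  then show ?case by (cases n) auto
qed simp

lemma concat_loops_walk:
  assumes "set ws \<subseteq> {walk k us k | us. set us \<subseteq> A}" "set vs \<subseteq> insert k A"
  shows "\<exists>vs'. set vs' \<subseteq> insert k A \<and> concat ws @ walk k vs j = walk k vs' j"
  using assms(1)
proof (induction ws)
  case Nil
  then show ?case using assms(2) by auto
next
  case (Cons w ws)
  then obtain vs' us where "set vs' \<subseteq> insert k A" "concat ws @ walk k vs j = walk k vs' j"
    "set us \<subseteq> A" "w = walk k us k" by auto
  then show ?case by (intro exI[of _ "us @ k # vs'"]) (auto simp: walk_append)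
qed

text \<open>Cut the walk at every visit of \<open>k\<close>. All pieces but the last are loops at
  \<open>k\<close>, and their inner vertices differ from \<open>k\<close>, so they lie in
  \<open>A\<close>.\<close>

lemma walk_split_loops:
  assumes "set vs \<subseteq> insert k A"
  shows "\<exists>ws us. set ws \<subseteq> {walk k us k | us. set us \<subseteq> A} \<and> set us \<subseteq> A \<and>
           walk k vs j = concat ws @ walk k us j"
  using assms
proof (induction vs rule: length_induct)
  case (1 vs)
  show ?case
  proof (cases "k \<in> set vs")
    case False
    then show ?thesis using 1(2) by (intro exI[of _ "[]"] exI[of _ vs]) auto
  next
    case True
    then obtain us vs' where vs: "vs = us @ k # vs'" "k \<notin> set us"
      by (meson split_list_first)
    then have "length vs' < length vs" "set vs' \<subseteq> insert k A" using 1(2) by auto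
    with 1(1) obtain ws us' where "set ws \<subseteq> {walk k us k | us. set us \<subseteq> A}" "set us' \<subseteq> A"
      "walk k vs' j = concat ws @ walk k us' j" by blast
    then show ?thesis using vs 1(2)
      by (intro exI[of _ "walk k us k # ws"] exI[of _ us']) (auto simp: walk_append)
  qed
qed

lemma lang_TimesI: "u \<in> lang r \<Longrightarrow> v \<in> lang s \<Longrightarrow> u @ v \<in> lang (Times r s)"
  by auto

lemma lang_StarI: "set ws \<subseteq> lang r \<Longrightarrow> concat ws \<in> lang (Star r)"
  by auto

lemma lang_chain: "lang (chain ks i j) = {walk i vs j | vs. set vs \<subseteq> set ks}"
proof (induction ks arbitrary: i j)
  case (Cons k ks)
  show ?case
  proof (intro equalityI subsetI)
    fix w assume "w \<in> lang (chain (k # ks) i j)"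
    then consider "w \<in> lang (chain ks i j)"
      | us ws vs where "w = walk i us k @ concat ws @ walk k vs j" "set us \<subseteq> set ks"
        "set vs \<subseteq> set ks" "set ws \<subseteq> {walk k us k | us. set us \<subseteq> set ks}"
      by (simp add: Cons) blast
    then show "w \<in> {walk i vs j | vs. set vs \<subseteq> set (k # ks)}"
    proof cases
      case 1
      then show ?thesis by (auto simp: Cons)
    next
      case 2
      then obtain vs' where "set vs' \<subseteq> insert k (set ks)" "concat ws @ walk k vs j = walk k vs' j"
        using concat_loops_walk[OF 2(4), of vs j] by blast
      with 2 show ?thesis by (auto simp flip: walk_append intro!: exI[of _ "us @ k # vs'"])
    qed
  next
    fix w assume "w \<in> {walk i vs j | vs. set vs \<subseteq> set (k # ks)}"
    then obtain vs where w: "w = walk i vs j" "set vs \<subseteq> insert k (set ks)" by auto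
    show "w \<in> lang (chain (k # ks) i j)"
    proof (cases "k \<in> set vs")
      case False
      with w have "w \<in> lang (chain ks i j)" unfolding Cons by blast
      then show ?thesis by simp
    next
      case True
      then obtain us vs' where vs: "vs = us @ k # vs'" "k \<notin> set us"
        by (meson split_list_first)
      with w obtain ws us' where *: "set ws \<subseteq> {walk k us k | us. set us \<subseteq> set ks}"
        "set us' \<subseteq> set ks" "walk k vs' j = concat ws @ walk k us' j"
        using walk_split_loops[of vs' k "set ks" j] by auto
      have "walk i us k \<in> lang (chain ks i k)" "walk k us' j \<in> lang (chain ks k j)"
        "set ws \<subseteq> lang (chain ks k k)"
        using w vs * by (auto simp: Cons)
      then have "walk i us k @ concat ws @ walk k us' j \<in>
          lang (Times (chain ks i k) (Times (Star (chain ks k k)) (chain ks k j)))"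
        by (intro lang_TimesI lang_StarI)
      then show ?thesis using w vs * by (simp add: walk_append)
    qed
  qed
qed simp

lemma letters_chain:
  "letters (chain ks i j) \<subseteq> prod_encode ` (insert i (set ks) \<times> insert j (set ks))"
  by (induction ks arbitrary: i j) fastforce+

lemma positive_chain: "positive (chain ks i j)"
  by (auto simp: positive_def lang_chain) (metis length_walk list.size(3) nat.simps(3))

section \<open>Rows as transitions between tape contents\<close>

text \<open>The pair letters of a row are split into the contents before and after a step. The
  common witness \<open>zs\<close> forces both to have the same length.\<close>

definition step :: "nat rexp \<Rightarrow> nat list \<Rightarrow> nat list \<Rightarrow> bool" where
  "step R u v \<longleftrightarrow> (\<exists>zs. map prod_encode zs \<in> lang R \<and> u = map fst zs \<and> v = map snd zs)"

lemma step_map: "step R (map f [0..<n]) (map g [0..<n]) \<longleftrightarrow>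
    map (\<lambda>j. prod_encode (f j, g j)) [0..<n] \<in> lang R"
proof
  assume "step R (map f [0..<n]) (map g [0..<n])"
  then obtain zs where zs: "map prod_encode zs \<in> lang R" "map f [0..<n] = map fst zs"
    "map g [0..<n] = map snd zs" unfolding step_def by blast
  have len: "length zs = n" using arg_cong[OF zs(2), of length] by simp
  have "zs ! j = (f j, g j)" if "j < n" for j
    using arg_cong[OF zs(2), of "\<lambda>l. l ! j"] arg_cong[OF zs(3), of "\<lambda>l. l ! j"] that len
    by (simp add: prod_eq_iff)
  then have "zs = map (\<lambda>j. (f j, g j)) [0..<n]"
    by (intro nth_equalityI) (simp_all add: len)
  then show "map (\<lambda>j. prod_encode (f j, g j)) [0..<n] \<in> lang R"
    using zs(1) by (simp add: comp_def)
next
  assume "map (\<lambda>j. prod_encode (f j, g j)) [0..<n] \<in> lang R"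
  then show "step R (map f [0..<n]) (map g [0..<n])"
    unfolding step_def by (intro exI[of _ "map (\<lambda>j. (f j, g j)) [0..<n]"]) (simp add: comp_def)
qed

text \<open>The column expression makes the second component of each letter agree with the first
  component of the letter below. An array of \<open>m\<close> rows of pairs is therefore the same as
  an array \<open>c\<close> with \<open>m + 1\<close> rows of contents, and the rows of pairs are
  the transitions between them.\<close>

lemma crossword_chain_iff:
  "(\<exists>a. crossword \<Sigma> R (chain V 0 1) m n a) \<longleftrightarrow>
     m \<ge> 1 \<and> n \<ge> 1 \<and>
     (\<exists>c. (\<forall>i<m. \<forall>j<n. prod_encode (c i j, c (Suc i) j) \<in> \<Sigma>) \<and>
        (\<forall>i<m. step R (map (c i) [0..<n]) (map (c (Suc i)) [0..<n])) \<and>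
        (\<forall>j<n. c 0 j = 0 \<and> c m j = 1) \<and>
        (\<forall>i j. 0 < i \<longrightarrow> i < m \<longrightarrow> j < n \<longrightarrow> c i j \<in> set V))" (is "?L \<longleftrightarrow> ?R")
proof
  assume ?L
  then obtain a where a: "m \<ge> 1" "n \<ge> 1" "\<forall>i<m. \<forall>j<n. a i j \<in> \<Sigma>"
    "\<forall>i<m. map (\<lambda>j. a i j) [0..<n] \<in> lang R"
    "\<forall>j<n. map (\<lambda>i. a i j) [0..<m] \<in> lang (chain V 0 1)"
    unfolding crossword_def by blast
  then have "\<forall>j<n. \<exists>vs. map (\<lambda>i. a i j) [0..<m] = walk 0 vs 1 \<and> set vs \<subseteq> set V"
    unfolding lang_chain by blast
  then obtain vs where vs: "\<And>j. j < n \<Longrightarrow> map (\<lambda>i. a i j) [0..<m] = walk 0 (vs j) 1"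
    "\<And>j. j < n \<Longrightarrow> set (vs j) \<subseteq> set V" by metis
  have len: "Suc (length (vs j)) = m" if "j < n" for j
    using arg_cong[OF vs(1)[OF that], of length] by simp
  \<comment> \<open>Column \<open>j\<close> has \<open>m\<close> edges, hence \<open>m - 1\<close>
    inner vertices, which together with the two ends give the rows \<open>0\<close> to
    \<open>m\<close> of \<open>c\<close>.\<close>
  define c where "c i j = (0 # vs j @ [1]) ! i" for i j
  have eq: "a i j = prod_encode (c i j, c (Suc i) j)" if "i < m" "j < n" for i j
  proof -
    have "a i j = walk 0 (vs j) 1 ! i"
      using arg_cong[OF vs(1)[OF that(2)], of "\<lambda>l. l ! i"] that by simp
    also have "\<dots> = prod_encode ((0 # vs j) ! i, (vs j @ [1]) ! i)"
      using that len[of j] by (intro walk_nth) auto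
    also have "(0 # vs j) ! i = c i j"
      using that len[of j] by (cases i) (auto simp: c_def nth_append)
    finally show ?thesis by (simp add: c_def)
  qed
  show ?R
  proof (intro conjI exI[of _ c] allI impI a(1,2))
    show "prod_encode (c i j, c (Suc i) j) \<in> \<Sigma>" if "i < m" "j < n" for i j
      using a(3) that by (simp flip: eq)
    show "step R (map (c i) [0..<n]) (map (c (Suc i)) [0..<n])" if "i < m" for i
    proof -
      have "map (\<lambda>j. a i j) [0..<n] = map (\<lambda>j. prod_encode (c i j, c (Suc i) j)) [0..<n]"
        using that by (simp add: eq)
      then show ?thesis unfolding step_map using a(4) that by metis
    qed
    show "c 0 j = 0" "c m j = 1" if "j < n" for j
      using len[OF that] by (auto simp: c_def nth_append)
    show "c i j \<in> set V" if "0 < i" "i < m" "j < n" for i j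
    proof -
      have "c i j = vs j ! (i - 1)" "i - 1 < length (vs j)"
        using that len[of j] by (cases i; auto simp: c_def nth_append)+
      then show ?thesis using vs(2)[OF that(3)] nth_mem by auto
    qed
  qed
next
  assume ?R
  then obtain c where mn: "m \<ge> 1" "n \<ge> 1" and
    c: "\<forall>i<m. \<forall>j<n. prod_encode (c i j, c (Suc i) j) \<in> \<Sigma>"
    "\<forall>i<m. step R (map (c i) [0..<n]) (map (c (Suc i)) [0..<n])"
    "\<forall>j<n. c 0 j = 0 \<and> c m j = 1"
    "\<forall>i j. 0 < i \<longrightarrow> i < m \<longrightarrow> j < n \<longrightarrow> c i j \<in> set V"
    by blast
  define a where "a i j = prod_encode (c i j, c (Suc i) j)" for i j
  have "map (\<lambda>i. a i j) [0..<m] \<in> lang (chain V 0 1)" if j: "j < n" for j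
  proof -
    define vs where "vs = map (\<lambda>i. c (Suc i) j) [0..<m - 1]"
    have "map (\<lambda>i. a i j) [0..<m] = walk 0 vs 1"
    proof (rule nth_equalityI)
      fix i assume "i < length (map (\<lambda>i. a i j) [0..<m])"
      then have i: "i < m" by simp
      have "walk 0 vs 1 ! i = prod_encode ((0 # vs) ! i, (vs @ [1]) ! i)"
        using i by (intro walk_nth) (auto simp: vs_def)
      also have "(0 # vs) ! i = c i j"
        using i c(3) j by (cases i) (auto simp: vs_def)
      also have "(vs @ [1]) ! i = c (Suc i) j"
      proof (cases "i < m - 1")
        case False
        with i have "Suc i = m" by simp
        then show ?thesis using c(3) j False by (auto simp: vs_def nth_append)
      qed (simp add: vs_def nth_append)
      finally show "map (\<lambda>i. a i j) [0..<m] ! i = walk 0 vs 1 ! i"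
        using i by (simp add: a_def)
    qed (use mn in \<open>simp add: vs_def\<close>)
    moreover have "set vs \<subseteq> set V" using c(4) j by (auto simp: vs_def)
    ultimately show ?thesis unfolding lang_chain by blast
  qed
  moreover have "map (\<lambda>j. a i j) [0..<n] \<in> lang R" if "i < m" for i
    using c(2) that unfolding step_map a_def by blast
  moreover have "\<forall>i<m. \<forall>j<n. a i j \<in> \<Sigma>" using c(1) by (simp add: a_def)
  ultimately show ?L unfolding crossword_def using mn by blast
qed

section \<open>Regular expressions for the steps of a Turing machine\<close>

lemma lang_foldr_Plus: "lang (foldr Plus rs r) = lang r \<union> (\<Union>s\<in>set rs. lang s)"
  by (induction rs) auto

lemma letters_foldr_Plus: "letters (foldr Plus rs r) = letters r \<union> (\<Union>s\<in>set rs. letters s)"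
  by (induction rs) auto

lemma lang_Star_image:
  assumes "lang r = (\<lambda>a. [f a]) ` A"
  shows "lang (Star r) = map f ` lists A"
proof (intro equalityI subsetI)
  fix w assume "w \<in> lang (Star r)"
  then obtain ws where "set ws \<subseteq> (\<lambda>a. [f a]) ` A" "w = concat ws" using assms by auto
  then show "w \<in> map f ` lists A"
  proof (induction ws arbitrary: w)
    case (Cons v ws)
    then obtain a l where "v = [f a]" "a \<in> A" "l \<in> lists A" "concat ws = map f l" by auto
    with Cons.prems show ?case by (intro image_eqI[of _ _ "a # l"]) auto
  qed auto
next
  fix w assume "w \<in> map f ` lists A"
  then obtain l where l: "l \<in> lists A" "w = map f l" by auto
  then have "set (map (\<lambda>a. [f a]) l) \<subseteq> lang r" using assms by auto
  moreover have "w = concat (map (\<lambda>a. [f a]) l)" using l(2) by (induction l arbitrary: w) auto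
  ultimately show "w \<in> lang (Star r)" using lang_StarI by blast
qed

text \<open>The symbols \<open>0\<close> and \<open>1\<close>, which are no cell contents, are the ends of the walks in the columns.
  The cell under the head also carries the state.\<close>

definition plain :: "nat \<Rightarrow> nat" where
  "plain a = prod_encode (0, a) + 2"

definition headed :: "nat \<Rightarrow> nat \<Rightarrow> nat" where
  "headed q a = prod_encode (Suc q, a) + 2"

lemma plain_headed_simps [simp]:
  "plain a \<noteq> 0" "plain a \<noteq> Suc 0" "headed q a \<noteq> 0" "headed q a \<noteq> Suc 0" "plain a \<noteq> headed q b" "headed q b \<noteq> plain a"
  "plain a = plain b \<longleftrightarrow> a = b" "headed q a = headed q' b \<longleftrightarrow> q = q' \<and> a = b"
  "0 \<noteq> plain a" "Suc 0 \<noteq> plain a" "0 \<noteq> headed q a" "Suc 0 \<noteq> headed q a"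
  by (auto simp: plain_def headed_def)

context
  fixes M :: tm
begin

text \<open>The blank, the input symbol \<open>1\<close> and all symbols that \<open>M\<close>
  writes: a run on a unary input never shows any other.\<close>

definition tape_symbols :: "nat list" where
  "tape_symbols = 0 # 1 # map (\<lambda>(_, _, b, _). b) M"

definition states :: "nat list" where
  "states = 0 # map (\<lambda>(_, q, _, _). q) M"

definition cell_symbols :: "nat list" where
  "cell_symbols = map plain tape_symbols @ [headed q a. q \<leftarrow> states, a \<leftarrow> tape_symbols]"

text \<open>No expression denotes the empty language, so the union needs a last summand.
  \<open>f 0\<close> can be repeated, since \<open>0\<close> is a tape symbol.\<close>

definition pairs_star :: "(nat \<Rightarrow> nat \<times> nat) \<Rightarrow> nat rexp" where
  "pairs_star f = Star (foldr Plus (map (\<lambda>a. Letter (prod_encode (f a))) tape_symbols)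
     (Letter (prod_encode (f 0))))"

definition same :: "nat rexp" where
  "same = pairs_star (\<lambda>a. (plain a, plain a))"

definition rewrite :: "nat \<times> nat \<Rightarrow> nat \<times> nat \<Rightarrow> nat rexp" where
  "rewrite x y = Times same (Times (Letter (prod_encode x)) (Times (Letter (prod_encode y)) same))"

definition finish :: "nat \<Rightarrow> nat \<Rightarrow> nat rexp" where
  "finish q a = Times (pairs_star (\<lambda>a. (plain a, 1)))
     (Times (Letter (prod_encode (headed q a, 1))) (pairs_star (\<lambda>a. (plain a, 1))))"

text \<open>The transition does not determine the content \<open>c\<close> of the cell that the head
  enters, hence one two-cell window for each \<open>c\<close>.\<close>

definition rules :: "nat \<Rightarrow> nat \<Rightarrow> nat rexp list" where
  "rules q a = (case map_of M (q, a) of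
     None \<Rightarrow> [finish q a]
   | Some (q', b, Move_Right) \<Rightarrow>
       map (\<lambda>c. rewrite (headed q a, plain b) (plain c, headed q' c)) tape_symbols
   | Some (q', b, Move_Left) \<Rightarrow>
       map (\<lambda>c. rewrite (plain c, headed q' c) (headed q a, plain b)) tape_symbols)"

primrec ones :: "nat \<Rightarrow> nat rexp" where
  "ones 0 = Eps"
| "ones (Suc x) = Times (Letter (prod_encode (0, plain 1))) (ones x)"

text \<open>The head stands on the first of \<open>Suc x\<close> ones. The two stars guess the
  space; the mandatory blank on the right excludes crosswords with a single column.\<close>

definition initial_row :: "nat \<Rightarrow> nat rexp" where
  "initial_row x = Times (Star (Letter (prod_encode (0, plain 0))))
     (Times (Letter (prod_encode (0, headed 0 1))) (Times (ones x)
       (Times (Letter (prod_encode (0, plain 0))) (Star (Letter (prod_encode (0, plain 0)))))))"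

definition row_rexp :: "nat \<Rightarrow> nat rexp" where
  "row_rexp x = foldr Plus [r. q \<leftarrow> states, a \<leftarrow> tape_symbols, r \<leftarrow> rules q a] (initial_row x)"

definition column_rexp :: "nat rexp" where
  "column_rexp = chain cell_symbols 0 1"

lemma zero_in_tape_symbols [simp]: "0 \<in> set tape_symbols"
  by (simp add: tape_symbols_def)

lemma lang_pairs_star:
  "lang (pairs_star f) = (\<lambda>l. map prod_encode (map f l)) ` lists (set tape_symbols)"
proof -
  have "lang (foldr Plus (map (\<lambda>a. Letter (prod_encode (f a))) tape_symbols) (Letter (prod_encode (f 0))))
      = (\<lambda>a. [prod_encode (f a)]) ` set tape_symbols"
    unfolding lang_foldr_Plus using zero_in_tape_symbols by auto
  from lang_Star_image[OF this] show ?thesis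
    by (simp add: pairs_star_def comp_def)
qed

lemma step_same_context:
  assumes "lang r = {map prod_encode zs}"
  shows "map prod_encode us \<in> lang (Times (pairs_star f) (Times r (pairs_star f))) \<longleftrightarrow>
    (\<exists>l\<in>lists (set tape_symbols). \<exists>l'\<in>lists (set tape_symbols). us = map f l @ zs @ map f l')"
    (is "?L \<longleftrightarrow> ?R")
proof -
  have inj: "inj (map prod_encode)" by (simp add: inj_prod_encode)
  have "?L \<longleftrightarrow> (\<exists>l\<in>lists (set tape_symbols). \<exists>l'\<in>lists (set tape_symbols).
      map prod_encode us = map prod_encode (map f l @ zs @ map f l'))"
    unfolding lang.simps assms lang_pairs_star map_append by blast
  then show ?thesis by (simp only: inj_eq[OF inj])
qed

lemma lang_rewrite: "map prod_encode us \<in> lang (rewrite x y) \<longleftrightarrow>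
    (\<exists>l\<in>lists (set tape_symbols). \<exists>l'\<in>lists (set tape_symbols).
       us = map (\<lambda>a. (plain a, plain a)) l @ x # y # map (\<lambda>a. (plain a, plain a)) l')"
proof -
  have "lang (rewrite x y) = lang (Times same (Times (Times (Letter (prod_encode x)) (Letter (prod_encode y))) same))"
    unfolding rewrite_def lang.simps by (intro Collect_cong) (force)
  then show ?thesis
    using step_same_context[of "Times (Letter (prod_encode x)) (Letter (prod_encode y))" "[x, y]"]
    by (simp add: same_def)
qed

lemma lang_finish: "map prod_encode us \<in> lang (finish q a) \<longleftrightarrow>
    (\<exists>l\<in>lists (set tape_symbols). \<exists>l'\<in>lists (set tape_symbols).
       us = map (\<lambda>a. (plain a, 1)) l @ (headed q a, 1) # map (\<lambda>a. (plain a, 1)) l')"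
  unfolding finish_def
  using step_same_context[of "Letter (prod_encode (headed q a, 1))" "[(headed q a, 1)]"] by simp

lemma lang_ones: "lang (ones x) = {map prod_encode (replicate x (0, plain 1))}"
  by (induction x) auto

lemma lang_initial_row: "map prod_encode us \<in> lang (initial_row x) \<longleftrightarrow>
    (\<exists>i k. us = map (Pair 0) (replicate i (plain 0) @ headed 0 1 # replicate x (plain 1) @
              replicate (Suc k) (plain 0)))" (is "?L \<longleftrightarrow> ?R")
proof -
  have inj: "inj (map prod_encode)" by (simp add: inj_prod_encode)
  have star: "lang (Star (Letter y)) = range (\<lambda>i. replicate i y)" for y :: nat
  proof -
    have "map (\<lambda>_. y) ` lists {()} = range (\<lambda>i. replicate i y)"
      by (auto simp: map_replicate_const intro: image_eqI[of _ _ "replicate _ ()"])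
    then show ?thesis using lang_Star_image[of "Letter y" "\<lambda>_. y" "{()}"] by simp
  qed
  let ?z = "prod_encode (0, plain 0)"
  have "lang (initial_row x) = {replicate i ?z @ prod_encode (0, headed 0 1) #
      replicate x (prod_encode (0, plain 1)) @ ?z # replicate k ?z | i k. True}"
    unfolding initial_row_def lang.simps(2,4) star lang_ones map_replicate
  proof (intro equalityI subsetI, goal_cases)
    case (1 w)
    then show ?case by (elim CollectE exE conjE rangeE singletonE) (simp, blast)
  next
    case (2 w)
    then show ?case by (elim CollectE exE) (simp, blast)
  qed
  then have "?L \<longleftrightarrow> (\<exists>i k. map prod_encode us = map prod_encode (map (Pair 0)
      (replicate i (plain 0) @ headed 0 1 # replicate x (plain 1) @ replicate (Suc k) (plain 0))))"
    by simp
  then show ?thesis by (simp only: inj_eq[OF inj])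
qed

lemma step_row_rexp_iff: "step (row_rexp x) u v \<longleftrightarrow>
    (\<exists>zs. u = map fst zs \<and> v = map snd zs \<and> (map prod_encode zs \<in> lang (initial_row x) \<or>
      (\<exists>q\<in>set states. \<exists>a\<in>set tape_symbols. \<exists>r\<in>set (rules q a). map prod_encode zs \<in> lang r)))"
  unfolding step_def row_rexp_def lang_foldr_Plus by auto

text \<open>Inversion of a row. All that soundness has to know about \<open>row_rexp\<close> is
  stated here in terms of contents, without expressions.\<close>

lemma step_row_rexp_cases:
  assumes "step (row_rexp x) u v"
  obtains
    (initial) i k where "u = replicate (length v) 0"
      "v = replicate i (plain 0) @ headed 0 1 # replicate x (plain 1) @ replicate (Suc k) (plain 0)"
  | (right) q a q' b c l l' where "map_of M (q, a) = Some (q', b, Move_Right)"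
      "u = map plain l @ headed q a # plain c # map plain l'"
      "v = map plain l @ plain b # headed q' c # map plain l'"
  | (left) q a q' b c l l' where "map_of M (q, a) = Some (q', b, Move_Left)"
      "u = map plain l @ plain c # headed q a # map plain l'"
      "v = map plain l @ headed q' c # plain b # map plain l'"
  | (finish) q a l l' where "map_of M (q, a) = None"
      "u = map plain l @ headed q a # map plain l'" "v = replicate (length u) 1"
proof -
  from assms obtain zs where zs: "u = map fst zs" "v = map snd zs"
    and or: "map prod_encode zs \<in> lang (initial_row x) \<or>
      (\<exists>q\<in>set states. \<exists>a\<in>set tape_symbols. \<exists>r\<in>set (rules q a). map prod_encode zs \<in> lang r)"
    unfolding step_row_rexp_iff by blast
  from or show thesis
  proof
    assume "map prod_encode zs \<in> lang (initial_row x)"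
    then obtain i k where "zs = map (Pair 0) (replicate i (plain 0) @ headed 0 1 #
        replicate x (plain 1) @ replicate (Suc k) (plain 0))" (is "_ = map (Pair 0) ?v")
      unfolding lang_initial_row by blast
    moreover have "map fst (map (Pair (0 :: nat)) l) = replicate (length l) 0"
      "map snd (map (Pair (0 :: nat)) l) = l" for l :: "nat list"
      by (induction l) auto
    ultimately have "v = ?v" "u = replicate (length v) 0" using zs by (simp_all only:)
    then show thesis using initial by blast
  next
    assume "\<exists>q\<in>set states. \<exists>a\<in>set tape_symbols. \<exists>r\<in>set (rules q a). map prod_encode zs \<in> lang r"
    then obtain q a r where r: "r \<in> set (rules q a)" "map prod_encode zs \<in> lang r" by blast
    show thesis
    proof (cases "map_of M (q, a)")
      case None
      with r(1) have "r = finish q a" by (simp add: rules_def)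
      with r(2) have "map prod_encode zs \<in> lang (finish q a)" by (simp only:)
      then obtain l l' where
        "zs = map (\<lambda>a. (plain a, 1)) l @ (headed q a, 1) # map (\<lambda>a. (plain a, 1)) l'"
        unfolding lang_finish by blast
      moreover from this zs have "v = replicate (length u) 1"
        by (intro replicate_eqI) auto
      ultimately show thesis
        using zs by (intro finish[OF None, of l l']) (simp_all add: comp_def)
    next
      case (Some y)
      obtain q' b d where y: "y = (q', b, d)" by (cases y)
      show thesis
      proof (cases d)
        case Move_Right
        with r(1) Some y obtain c where "r = rewrite (headed q a, plain b) (plain c, headed q' c)"
          by (auto simp: rules_def)
        with r(2) have "map prod_encode zs \<in> lang (rewrite (headed q a, plain b) (plain c, headed q' c))"
          by (simp only:)
        then obtain l l' where "zs = map (\<lambda>a. (plain a, plain a)) l @ (headed q a, plain b) #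
            (plain c, headed q' c) # map (\<lambda>a. (plain a, plain a)) l'"
          unfolding lang_rewrite by blast
        with zs Some y Move_Right show thesis
          by (intro right[of q a q' b l c l']) (simp_all add: comp_def)
      next
        case Move_Left
        with r(1) Some y obtain c where "r = rewrite (plain c, headed q' c) (headed q a, plain b)"
          by (auto simp: rules_def)
        with r(2) have "map prod_encode zs \<in> lang (rewrite (plain c, headed q' c) (headed q a, plain b))"
          by (simp only:)
        then obtain l l' where "zs = map (\<lambda>a. (plain a, plain a)) l @ (plain c, headed q' c) #
            (headed q a, plain b) # map (\<lambda>a. (plain a, plain a)) l'"
          unfolding lang_rewrite by blast
        with zs Some y Move_Left show thesis
          by (intro left[of q a q' b l c l']) (simp_all add: comp_def)
      qed
    qed
  qed
qed

section \<open>Every crossword describes a halting computation\<close>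

primrec cell_symbol :: "config \<Rightarrow> int \<Rightarrow> nat" where
  "cell_symbol (q, ht) z =
     (if z = fst ht then headed q (snd ht z) else plain (snd ht z))"

text \<open>A crossword shows a fixed window of the tape; \<open>z\<close> is the tape position of
  its left end.\<close>

definition word :: "int \<Rightarrow> nat \<Rightarrow> config \<Rightarrow> nat list" where
  "word z n c = map (\<lambda>j. cell_symbol c (z + int j)) [0..<n]"

lemma length_word [simp]: "length (word z n c) = n"
  by (simp add: word_def)

lemma word_nth [simp]: "j < n \<Longrightarrow> word z n c ! j = cell_symbol c (z + int j)"
  by (simp add: word_def)

lemma word_eq_update_two:
  assumes "word z n (q, h, t) = ls @ x # y # rs"
    and "cell_symbol c (z + int (length ls)) = x'" "cell_symbol c (z + int (length ls) + 1) = y'"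
    and "\<And>i. i \<noteq> z + int (length ls) \<Longrightarrow> i \<noteq> z + int (length ls) + 1 \<Longrightarrow>
      cell_symbol c i = cell_symbol (q, h, t) i"
  shows "word z n c = ls @ x' # y' # rs"
proof -
  have "length (word z n (q, h, t)) = length ls + 2 + length rs"
    unfolding assms(1) by simp
  then have n: "n = length ls + 2 + length rs" by simp
  have "ls @ x' # y' # rs = (word z n (q, h, t))[length ls := x', Suc (length ls) := y']"
    unfolding assms(1) by (simp add: list_update_append)
  then show ?thesis
    using assms(2-4) n by (intro nth_equalityI) (auto simp: nth_list_update add.assoc add.commute[of 1])
qed

text \<open>The invariant of the contents in a crossword: not yet written, a window on a reachable
  configuration, or wiped after halting. The position \<open>z\<close> is existential, as it depends
  on the blanks chosen in the initial row.\<close>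

definition reached :: "nat \<Rightarrow> nat \<Rightarrow> nat list \<Rightarrow> bool" where
  "reached x n u \<longleftrightarrow> u = replicate n 0 \<or>
     (\<exists>z c. (\<lambda>c c'. tm_step M c = Some c')\<^sup>*\<^sup>* (initial_config (replicate (Suc x) 1)) c \<and> u = word z n c) \<or>
     (halts_on M (replicate (Suc x) 1) \<and> u = replicate n 1)"

lemma initial_config_ones: "initial_config (replicate (Suc x) 1) =
    (0, 0, \<lambda>i. if 0 \<le> i \<and> i < int (Suc x) then 1 else 0)"
  by (auto simp: initial_config_def fun_eq_iff simp del: replicate_Suc)

lemma word_initial: "n = i + 1 + x + Suc k \<Longrightarrow>
    word (- int i) n (initial_config (replicate (Suc x) 1)) =
    replicate i (plain 0) @ headed 0 1 # replicate x (plain 1) @ replicate (Suc k) (plain 0)"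
  unfolding initial_config_ones
  by (rule nth_equalityI) (auto simp: nth_append nth_Cons' simp del: replicate_Suc)

lemma step_reached:
  assumes "step (row_rexp x) u v" "reached x n u"
  shows "reached x n v"
  using assms(1)
proof (cases rule: step_row_rexp_cases)
  case (initial i k)
  have "length u = n" using assms(2) by (auto simp: reached_def)
  with initial have "n = i + 1 + x + Suc k" by (metis length_replicate length_append length_Cons add.assoc add_Suc_right plus_1_eq_Suc add_Suc)
  from word_initial[OF this] initial(2)
  have "v = word (- int i) n (initial_config (replicate (Suc x) 1))" by (simp only:)
  then show ?thesis unfolding reached_def by blast
next
  case (right q a q' b c l l')
  \<comment> \<open>Only the second alternative of \<open>reached\<close> contains a headed
    symbol.\<close>
  from right(2) have "headed q a \<in> set u" by simp
  with assms(2) obtain z q0 h t where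
    T: "(\<lambda>c c'. tm_step M c = Some c')\<^sup>*\<^sup>* (initial_config (replicate (Suc x) 1)) (q0, h, t)"
    and u: "u = word z n (q0, h, t)" by (auto simp: reached_def)
  have n: "n = length l + 2 + length l'" using arg_cong[OF u, of length] right(2) by simp
  have "u ! length l = headed q a" "u ! Suc (length l) = plain c"
    unfolding right(2) by (simp_all add: nth_append)
  then have *: "h = z + int (length l)" "q0 = q" "t h = a" "t (h + 1) = c"
    using n by (auto simp: u add.commute add.left_commute split: if_splits)
  have "tm_step M (q0, h, t) = Some (q', h + 1, t(h := b))" using * right(1) by simp
  with T have "(\<lambda>c c'. tm_step M c = Some c')\<^sup>*\<^sup>* (initial_config (replicate (Suc x) 1)) (q', h + 1, t(h := b))"
    by (rule rtranclp.rtrancl_into_rtrancl)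
  moreover have "word z n (q', h + 1, t(h := b)) = v"
    unfolding right(3)
    by (rule word_eq_update_two[OF trans[OF u[symmetric] right(2)]]) (use * in auto)
  ultimately show ?thesis unfolding reached_def by blast
next
  case (left q a q' b c l l')
  from left(2) have "headed q a \<in> set u" by simp
  with assms(2) obtain z q0 h t where
    T: "(\<lambda>c c'. tm_step M c = Some c')\<^sup>*\<^sup>* (initial_config (replicate (Suc x) 1)) (q0, h, t)"
    and u: "u = word z n (q0, h, t)" by (auto simp: reached_def)
  have n: "n = length l + 2 + length l'" using arg_cong[OF u, of length] left(2) by simp
  have "u ! length l = plain c" "u ! Suc (length l) = headed q a"
    unfolding left(2) by (simp_all add: nth_append)
  then have *: "h = z + int (length l) + 1" "q0 = q" "t h = a" "t (h - 1) = c"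
    using n by (auto simp: u add.commute add.left_commute split: if_splits)
  have "tm_step M (q0, h, t) = Some (q', h - 1, t(h := b))" using * left(1) by simp
  with T have "(\<lambda>c c'. tm_step M c = Some c')\<^sup>*\<^sup>* (initial_config (replicate (Suc x) 1)) (q', h - 1, t(h := b))"
    by (rule rtranclp.rtrancl_into_rtrancl)
  moreover have "word z n (q', h - 1, t(h := b)) = v"
    unfolding left(3)
    by (rule word_eq_update_two[OF trans[OF u[symmetric] left(2)]]) (use * in auto)
  ultimately show ?thesis unfolding reached_def by blast
next
  case (finish q a l l')
  from finish(2) have "headed q a \<in> set u" by simp
  with assms(2) obtain z q0 h t where
    T: "(\<lambda>c c'. tm_step M c = Some c')\<^sup>*\<^sup>* (initial_config (replicate (Suc x) 1)) (q0, h, t)"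
    and u: "u = word z n (q0, h, t)" by (auto simp: reached_def)
  from \<open>headed q a \<in> set u\<close> have "q0 = q" "t h = a"
    by (auto simp: u word_def split: if_splits)
  then have "tm_step M (q0, h, t) = None" using finish(1) by simp
  with T have "halts_on M (replicate (Suc x) 1)" unfolding halts_on_def by blast
  moreover have "length u = n" by (simp add: u)
  ultimately show ?thesis using finish(3) by (simp add: reached_def)
qed

text \<open>The source of plurality. Only the initial row can start from all \<open>0\<close>; it
  needs a head cell and a blank, and it writes cell symbols, which differ from
  \<open>1\<close>.\<close>

lemma step_from_zeros:
  assumes "step (row_rexp x) (replicate n 0) v" "n > 0"
  shows "n \<ge> 2 \<and> v \<noteq> replicate n 1"
  using assms(1)
proof (cases rule: step_row_rexp_cases)
  case (initial i k)
  have "length v = n" using arg_cong[OF initial(1), of length] by simp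
  moreover have "headed 0 1 \<in> set v" "length v \<ge> 2" using initial(2) by simp_all
  moreover have "headed 0 1 \<notin> set (replicate n 1)" by simp
  ultimately show ?thesis by metis
next
  case (right q a q' b c l l')
  then have "headed q a \<in> set (replicate n 0)" by simp
  then show ?thesis by (simp split: if_splits)
next
  case (left q a q' b c l l')
  then have "headed q a \<in> set (replicate n 0)" by simp
  then show ?thesis by (simp split: if_splits)
next
  case (finish q a l l')
  then have "headed q a \<in> set (replicate n 0)" by simp
  then show ?thesis by (simp split: if_splits)
qed

lemma crossword_imp:
  assumes "crossword \<Sigma> (row_rexp x) column_rexp m n a"
  shows "m \<ge> 2 \<and> n \<ge> 2 \<and> halts_on M (replicate (Suc x) 1)"
proof -
  have "\<exists>a. crossword \<Sigma> (row_rexp x) column_rexp m n a" using assms by blast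
  then obtain c where mn: "m \<ge> 1" "n \<ge> 1"
    and c: "\<forall>i<m. step (row_rexp x) (map (c i) [0..<n]) (map (c (Suc i)) [0..<n])"
      "\<forall>j<n. c 0 j = 0 \<and> c m j = 1"
    unfolding column_rexp_def crossword_chain_iff by blast
  have zeros: "map (c 0) [0..<n] = replicate n 0" and ones: "map (c m) [0..<n] = replicate n 1"
    using c(2) by (auto intro!: nth_equalityI)
  have "step (row_rexp x) (replicate n 0) (map (c 1) [0..<n])"
    using c(1)[rule_format, of 0] mn by (simp add: zeros)
  from step_from_zeros[OF this] mn have "n \<ge> 2" "map (c 1) [0..<n] \<noteq> replicate n 1" by auto
  \<comment> \<open>In a crossword with one row, the step from all \<open>0\<close> would lead to
    all \<open>1\<close> at once.\<close>
  moreover from this ones mn have "m \<ge> 2" by (cases "m = 1") auto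
  moreover have "reached x n (map (c i) [0..<n])" if "i \<le> m" for i
    using that
  proof (induction i)
    case 0
    show ?case by (simp add: zeros reached_def)
  next
    case (Suc i)
    show ?case by (rule step_reached[of x "map (c i) [0..<n]"]) (use Suc c(1) mn in auto)
  qed
  then have "reached x n (replicate n 1)" by (metis ones order_refl)
  then have "halts_on M (replicate (Suc x) 1)"
  proof -
    have "replicate n 1 \<noteq> word z n c" for z c
    proof
      assume "replicate n 1 = word z n c"
      then have "replicate n 1 ! 0 = word z n c ! 0" by simp
      then show False using mn by (cases c) (auto split: if_splits)
    qed
    moreover have "replicate n (1::nat) \<noteq> replicate n 0" using mn by (cases n) auto
    ultimately show ?thesis using \<open>reached x n (replicate n 1)\<close> unfolding reached_def by blast
  qed
  ultimately show ?thesis by blast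
qed

section \<open>Every halting computation yields a crossword\<close>

lemma step_row_rexpI:
  assumes "q \<in> set states" "a \<in> set tape_symbols" "r \<in> set (rules q a)"
    and "map (\<lambda>j. prod_encode (f j, g j)) [0..<n] \<in> lang r"
  shows "step (row_rexp x) (map f [0..<n]) (map g [0..<n])"
  unfolding step_row_rexp_iff
  using assms by (intro exI[of _ "map (\<lambda>j. (f j, g j)) [0..<n]"]) (auto simp: comp_def)

lemma word_step:
  assumes "tm_step M (q, h, t) = Some c'" "q \<in> set states" "range t \<subseteq> set tape_symbols"
    and "z < h" "h + 1 < z + int n"
  shows "step (row_rexp x) (word z n (q, h, t)) (word z n c')"
proof -
  from assms(1) obtain q' b d where M: "map_of M (q, t h) = Some (q', b, d)"
    and c': "c' = (q', h + offset d, t(h := b))"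
    by (auto split: option.splits prod.splits)
  let ?dup = "\<lambda>a. (plain a, plain a)"
  let ?f = "\<lambda>j. (cell_symbol (q, h, t) (z + int j), cell_symbol c' (z + int j))"
  have A: "t i \<in> set tape_symbols" for i using assms(3) by blast
  then have lists: "map (\<lambda>j. t (z + int j)) js \<in> lists (set tape_symbols)" for js
    by (simp add: in_lists_conv_set)
  \<comment> \<open>\<open>p\<close> is the left cell of the rewritten window: the head cell itself
    for a move to the right, its left neighbour for a move to the left.\<close>
  define e where "e = (if d = Move_Right then 0 else 1 :: nat)"
  define p where "p = nat (h - z) - e"
  have p: "z + int p = h - int e" "Suc p < n"
    using assms(4,5) by (auto simp: p_def e_def split: if_splits)
  have "[0..<n] = [0..<p] @ p # Suc p # [Suc (Suc p)..<n]"
    using p(2) by (metis Suc_lessD le0 upt_add_eq_append upt_conv_Cons le_add_diff_inverse less_imp_le_nat)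
  then have "map ?f [0..<n] = map ?f [0..<p] @ ?f p # ?f (Suc p) # map ?f [Suc (Suc p)..<n]"
    by (simp only: list.map map_append)
  also have "map ?f [0..<p] = map ?dup (map (\<lambda>j. t (z + int j)) [0..<p])"
    using p by (cases d) (auto simp: c' e_def)
  also have "map ?f [Suc (Suc p)..<n] = map ?dup (map (\<lambda>j. t (z + int j)) [Suc (Suc p)..<n])"
    using p by (cases d) (auto simp: c' e_def)
  finally have eq: "map ?f [0..<n] = map ?dup (map (\<lambda>j. t (z + int j)) [0..<p]) @ ?f p # ?f (Suc p) #
      map ?dup (map (\<lambda>j. t (z + int j)) [Suc (Suc p)..<n])" .
  have "map prod_encode (map ?f [0..<n]) \<in> lang (rewrite (?f p) (?f (Suc p)))"
    unfolding lang_rewrite eq using lists by blast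
  moreover have "rewrite (?f p) (?f (Suc p)) \<in> set (rules q (t h))"
  proof (cases d)
    case Move_Right
    with p have "?f p = (headed q (t h), plain b)"
      "?f (Suc p) = (plain (t (h + 1)), headed q' (t (h + 1)))"
      by (auto simp: c' e_def algebra_simps)
    then show ?thesis using A Move_Right M by (simp add: rules_def)
  next
    case Move_Left
    with p have "?f (Suc p) = (headed q (t h), plain b)"
      "?f p = (plain (t (h - 1)), headed q' (t (h - 1)))"
      by (auto simp: c' e_def algebra_simps)
    then show ?thesis using A Move_Left M by (simp add: rules_def)
  qed
  ultimately show ?thesis
    unfolding word_def by (intro step_row_rexpI[OF assms(2) A]) (simp_all add: comp_def)
qed

lemma word_finish:
  assumes "tm_step M (q, h, t) = None" "q \<in> set states" "range t \<subseteq> set tape_symbols"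
    and "z \<le> h" "h < z + int n"
  shows "step (row_rexp x) (word z n (q, h, t)) (map (\<lambda>_. 1) [0..<n])"
proof -
  from assms(1) have M: "map_of M (q, t h) = None" by (auto split: option.splits prod.splits)
  let ?dup = "\<lambda>a. (plain a, 1)"
  let ?f = "\<lambda>j. (cell_symbol (q, h, t) (z + int j), 1)"
  have A: "t i \<in> set tape_symbols" for i using assms(3) by blast
  then have lists: "map (\<lambda>j. t (z + int j)) js \<in> lists (set tape_symbols)" for js
    by (simp add: in_lists_conv_set)
  define p where "p = nat (h - z)"
  have p: "z + int p = h" "p < n" using assms(4,5) by (auto simp: p_def)
  have "[0..<n] = [0..<p] @ p # [Suc p..<n]"
    using p(2) by (metis le0 upt_add_eq_append upt_conv_Cons le_add_diff_inverse less_imp_le_nat)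
  then have "map ?f [0..<n] = map ?f [0..<p] @ ?f p # map ?f [Suc p..<n]"
    by (simp only: list.map map_append)
  also have "map ?f [0..<p] = map ?dup (map (\<lambda>j. t (z + int j)) [0..<p])"
    using p by auto
  also have "map ?f [Suc p..<n] = map ?dup (map (\<lambda>j. t (z + int j)) [Suc p..<n])"
    using p by auto
  also have "?f p = (headed q (t h), 1)" using p by simp
  finally have eq: "map ?f [0..<n] = map ?dup (map (\<lambda>j. t (z + int j)) [0..<p]) @ (headed q (t h), 1) #
      map ?dup (map (\<lambda>j. t (z + int j)) [Suc p..<n])" .
  have "map prod_encode (map ?f [0..<n]) \<in> lang (finish q (t h))"
    unfolding lang_finish eq using lists by blast
  moreover have "finish q (t h) \<in> set (rules q (t h))" using M by (simp add: rules_def)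
  ultimately show ?thesis
    unfolding word_def by (intro step_row_rexpI[OF assms(2) A]) (simp_all add: comp_def)
qed

lemma map_of_in_alphabet:
  assumes "map_of M (q, a) = Some (q', b, d)"
  shows "q' \<in> set states" "b \<in> set tape_symbols"
  using map_of_SomeD[OF assms] by (force simp: states_def tape_symbols_def)+

definition alphabet :: "nat set" where
  "alphabet = (let S = insert 0 (insert 1 (set cell_symbols)) in prod_encode ` (S \<times> S))"

lemma cell_symbol_in:
  "q \<in> set states \<Longrightarrow> range t \<subseteq> set tape_symbols \<Longrightarrow> cell_symbol (q, h, t) i \<in> set cell_symbols"
  by (auto simp: cell_symbols_def)

lemma halts_imp_crossword:
  assumes "halts_on M (replicate (Suc x) 1)"
  shows "\<exists>m n a. crossword alphabet (row_rexp x) column_rexp m n a"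
proof -
  let ?init = "initial_config (replicate (Suc x) 1)"
  from assms obtain d where "(\<lambda>c c'. tm_step M c = Some c')\<^sup>*\<^sup>* ?init d" and d: "tm_step M d = None"
    unfolding halts_on_def by blast
  then obtain k where "((\<lambda>c c'. tm_step M c = Some c') ^^ k) ?init d"
    using rtranclp_imp_relpowp[of _ ?init d] by blast
  then obtain f where f: "f 0 = ?init" "f k = d" "\<And>i. i < k \<Longrightarrow> tm_step M (f i) = Some (f (Suc i))"
    unfolding relpowp_fun_conv by blast
  have inv: "fst (f i) \<in> set states \<and> range (snd (snd (f i))) \<subseteq> set tape_symbols \<and>
      \<bar>fst (snd (f i))\<bar> \<le> int i" if "i \<le> k" for i
    using that
  proof (induction i)
    case 0
    show ?case unfolding f(1) initial_config_ones by (auto simp: states_def tape_symbols_def)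
  next
    case (Suc i)
    obtain q h t where fi: "f i = (q, h, t)" by (cases "f i")
    with f(3)[of i] Suc.prems obtain q' b d where
      "map_of M (q, t h) = Some (q', b, d)" "f (Suc i) = (q', h + offset d, t(h := b))"
      by (auto split: option.splits prod.splits)
    with Suc map_of_in_alphabet[of q "t h"] fi show ?case
      by (cases d) (auto simp: image_subset_iff)
  qed
  \<comment> \<open>Within \<open>k\<close> steps the head stays at distance at most
    \<open>k\<close> from its start. \<open>Suc k\<close> blanks before the input and
    \<open>Suc (Suc k)\<close> after it keep both neighbours of the head inside the window.\<close>
  define z where "z = - int (Suc k)"
  define n where "n = Suc k + 1 + x + Suc (Suc k)"
  \<comment> \<open>The \<open>k + 1\<close> configurations stand between a line of \<open>0\<close>
    and a line of \<open>1\<close>, which makes \<open>k + 2\<close> transitions, the rows of the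
    crossword.\<close>
  define c where "c i j = (if i = 0 then 0 else if i \<le> Suc k then cell_symbol (f (i - 1)) (z + int j) else 1)"
    for i j
  have rows: "map (c 0) [0..<n] = replicate n 0" "map (c (Suc (Suc k))) [0..<n] = map (\<lambda>_. 1) [0..<n]"
    "map (c (Suc i)) [0..<n] = word z n (f i)" if "i \<le> k" for i
    using that by (auto simp: c_def word_def list_eq_iff_nth_eq)
  have sym: "c (Suc i) j \<in> set cell_symbols" if "i \<le> k" for i j
    using inv[OF that] that by (cases "f i") (auto simp: c_def simp del: cell_symbol.simps intro!: cell_symbol_in)
  have step: "step (row_rexp x) (map (c i) [0..<n]) (map (c (Suc i)) [0..<n])" if "i < Suc (Suc k)" for i
  proof (cases i)
    case 0
    define zs :: "(nat \<times> nat) list" where zs: "zs = map (Pair 0) (replicate (Suc k) (plain 0) @ headed 0 1 # replicate x (plain 1) @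
              replicate (Suc (Suc k)) (plain 0))"
    have "word z n (f 0) = map snd zs"
      unfolding f(1) z_def zs using word_initial[of n "Suc k" x "Suc k"]
      by (simp add: n_def comp_def del: replicate_Suc)
    moreover have "replicate n 0 = map fst zs"
      by (rule replicate_eqI[symmetric]) (auto simp: zs n_def)
    moreover have "map prod_encode zs \<in> lang (initial_row x)"
      unfolding lang_initial_row zs by blast
    ultimately show ?thesis using rows(1,3)[of 0] 0 unfolding step_row_rexp_iff by auto
  next
    case (Suc i')
    obtain q h t where fi: "f i' = (q, h, t)" by (cases "f i'")
    have i': "i' \<le> k" using Suc that by simp
    have bounds: "z < h" "h + 1 < z + int n" using inv[OF i'] fi i' by (auto simp: z_def n_def)
    show ?thesis
    proof (cases "i' = k")
      case True
      with d f(2) fi have "tm_step M (q, h, t) = None" by simp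
      then have "step (row_rexp x) (word z n (q, h, t)) (map (\<lambda>_. 1) [0..<n])"
        by (rule word_finish) (use inv[OF i'] fi bounds in auto)
      then show ?thesis unfolding Suc True using rows(2,3)[OF i'] True fi by (simp only:)
    next
      case False
      with f(3)[of i'] i' fi have "tm_step M (q, h, t) = Some (f (Suc i'))" by simp
      then have "step (row_rexp x) (word z n (q, h, t)) (word z n (f (Suc i')))"
        by (rule word_step) (use inv[OF i'] fi bounds in auto)
      then show ?thesis using rows(3)[OF i'] rows(3)[of "Suc i'"] Suc False i' fi by simp
    qed
  qed
  have all: "c i j \<in> insert 0 (insert 1 (set cell_symbols))" for i j
    using sym[of "i - 1" j] by (cases i) (auto simp: c_def)
  have "\<exists>a. crossword alphabet (row_rexp x) column_rexp (Suc (Suc k)) n a"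
    unfolding column_rexp_def crossword_chain_iff
  proof (intro conjI exI[of _ c] allI impI)
    show "prod_encode (c i j, c (Suc i) j) \<in> alphabet" for i j
      unfolding alphabet_def Let_def using all by blast
    show "c i j \<in> set cell_symbols" if "0 < i" "i < Suc (Suc k)" for i j
      using sym[of "i - 1" j] that by simp
  qed (use step in \<open>auto simp: n_def c_def\<close>)
  then show ?thesis by blast
qed

section \<open>Letters, positivity and plurality of the expressions\<close>

lemma finite_alphabet: "finite alphabet"
  by (simp add: alphabet_def Let_def)

lemma letters_column_rexp: "letters column_rexp \<subseteq> alphabet"
  unfolding column_rexp_def alphabet_def Let_def
  by (rule order_trans[OF letters_chain]) auto

lemma plain_in_cell_symbols [simp]: "a \<in> set tape_symbols \<Longrightarrow> plain a \<in> set cell_symbols"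
  by (simp add: cell_symbols_def)

lemma headed_in_cell_symbols [simp]:
  "q \<in> set states \<Longrightarrow> a \<in> set tape_symbols \<Longrightarrow> headed q a \<in> set cell_symbols"
  by (auto simp: cell_symbols_def)

lemma in_alphabet: "u \<in> insert 0 (insert 1 (set cell_symbols)) \<Longrightarrow>
    v \<in> insert 0 (insert 1 (set cell_symbols)) \<Longrightarrow> prod_encode (u, v) \<in> alphabet"
  unfolding alphabet_def Let_def by blast

lemma letters_row_rexp: "letters (row_rexp x) \<subseteq> alphabet"
proof -
  have one: "1 \<in> set tape_symbols" "0 \<in> set states"
    by (simp_all add: tape_symbols_def states_def)
  have "letters (ones x) \<subseteq> alphabet"
    using one by (induction x) (auto intro!: in_alphabet)
  then have "letters (initial_row x) \<subseteq> alphabet"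
    using one unfolding initial_row_def by (auto intro!: in_alphabet)
  moreover have "letters r \<subseteq> alphabet"
    if "q \<in> set states" "a \<in> set tape_symbols" "r \<in> set (rules q a)" for q a r
    using that map_of_in_alphabet[of q a]
    by (auto simp: rules_def finish_def rewrite_def same_def pairs_star_def letters_foldr_Plus
        intro!: in_alphabet split: option.splits prod.splits move.splits)
      (metis move.exhaust)
  ultimately show ?thesis unfolding row_rexp_def letters_foldr_Plus by auto (meson subsetD)
qed

lemma positive_row_rexp: "positive (row_rexp x)"
proof -
  have "[] \<notin> lang (initial_row x)" by (simp add: initial_row_def)
  moreover have "[] \<notin> lang r" if "r \<in> set (rules q a)" for q a r
    using that by (auto simp: rules_def finish_def rewrite_def split: option.splits prod.splits move.splits)
      (metis move.exhaust)
  ultimately show ?thesis unfolding positive_def row_rexp_def lang_foldr_Plus by auto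
qed

lemma plural_row_column: "plural \<Sigma> (row_rexp x) column_rexp"
  unfolding plural_def using positive_row_rexp crossword_imp
  by (simp add: column_rexp_def positive_chain)

end

section \<open>Semidecidability of the Halting Problem\<close>

lemma cdrop_ctl: "cdrop (ctl l) i = ctl (cdrop l i)"
  by (induction i) (auto simp: cdrop_def)

lemma cnth_0: "cnth l 0 = chd l" and cnth_Suc: "cnth l (Suc i) = cnth (ctl l) i"
  by (simp_all add: cnth_def cdrop_def flip: cdrop_ctl) (simp add: cdrop_def flip: cdrop_ctl[unfolded cdrop_def])

lemma cnth_ccons: "cnth (ccons a l) i = (case i of 0 \<Rightarrow> a | Suc j \<Rightarrow> cnth l j)"
  by (simp add: cnth_0 cnth_Suc split: nat.split)

lemma cnth_list_encode_default: "cnth (list_encode xs) i = (if i < length xs then xs ! i else 0)"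
  by (simp add: cnth_list_encode) (simp add: cnth_def)

text \<open>The table is scanned from the end, so that the first matching entry overrides all later
  ones; the code \<open>T\<close> itself bounds the length. The result \<open>0\<close> means no
  entry, \<open>Suc v\<close> the entry \<open>v\<close>. The test with \<open>cdrop\<close> keeps
  the default value \<open>0\<close> beyond the end from matching the key \<open>0\<close>.\<close>

definition lookup :: "nat \<Rightarrow> nat \<Rightarrow> nat" where
  "lookup T key = rec_nat 0 (\<lambda>k r.
     if cdrop T (T - Suc k) \<noteq> 0 \<and> p1 (cnth T (T - Suc k)) = key
     then Suc (p2 (cnth T (T - Suc k))) else r) T"

lemma total_computable_lookup [computable_intros]:
  assumes "total_computable f" "total_computable g"
  shows "total_computable (\<lambda>x. lookup (f x) (g x))"
proof (rule total_computable_comp2[OF _ assms])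
  show "total_computable (\<lambda>z. lookup (p1 z) (p2 z))"
    unfolding lookup_def by (intro computable_intros)
qed

lemma lookup_tm_code: "lookup (tm_code M) (prod_encode (q, a)) =
    (case map_of M (q, a) of None \<Rightarrow> 0
     | Some (q', b, d) \<Rightarrow> Suc (prod_encode (q', prod_encode (b, move_code d))))"
proof -
  let ?T = "tm_code M"
  let ?res = "\<lambda>M. (case map_of M (q, a) of None \<Rightarrow> 0
     | Some (q', b, d) \<Rightarrow> Suc (prod_encode (q', prod_encode (b, move_code d))))"
  let ?f = "\<lambda>k r. if cdrop ?T (?T - Suc k) \<noteq> 0 \<and> p1 (cnth ?T (?T - Suc k)) = prod_encode (q, a)
     then Suc (p2 (cnth ?T (?T - Suc k))) else r"
  have len: "length M \<le> ?T"
    using length_le_list_encode[of "map entry_code M"] by (simp add: tm_code_def)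
  \<comment> \<open>After \<open>k\<close> rounds the entries from position \<open>?T - k\<close> on
    have been searched.\<close>
  have "rec_nat 0 ?f k = ?res (drop (?T - k) M)" if "k \<le> ?T" for k
    using that
  proof (induction k)
    case 0
    then show ?case using len by simp
  next
    case (Suc k)
    define i where "i = ?T - Suc k"
    have i: "?T - k = Suc i" using Suc.prems by (simp add: i_def)
    have IH: "rec_nat 0 ?f k = ?res (drop (Suc i) M)" using Suc i by simp
    show ?case
    proof (cases "i < length M")
      case False
      then have "cdrop ?T i = 0" by (simp add: tm_code_def)
      then show ?thesis using IH False by (simp add: i_def[symmetric])
    next
      case True
      obtain q0 a0 q' b d where e: "M ! i = ((q0, a0), (q', b, d))" by (metis prod.collapse)
      have "cdrop ?T i \<noteq> 0" using True by (simp add: tm_code_def)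
      moreover have "cnth ?T i = entry_code (M ! i)"
        using True by (simp add: tm_code_def cnth_list_encode)
      moreover have "drop i M = M ! i # drop (Suc i) M" using True by (rule Cons_nth_drop_Suc[symmetric])
      ultimately show ?thesis using IH by (simp add: i_def[symmetric] e)
    qed
  qed
  from this[of ?T] show ?thesis by (simp add: lookup_def)
qed

text \<open>A configuration is coded by the state, the tape to the left of the head (read leftwards) and the
  tape from the head on.\<close>

definition config_key :: "nat \<Rightarrow> nat" where
  "config_key s = prod_encode (p1 s, chd (p2 (p2 s)))"

definition apply_entry :: "nat \<Rightarrow> nat \<Rightarrow> nat" where
  "apply_entry v s =
     (if p2 (p2 v) = 0
      then prod_encode (p1 v, prod_encode (ctl (p1 (p2 s)),
             ccons (chd (p1 (p2 s))) (ccons (p1 (p2 v)) (ctl (p2 (p2 s))))))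
      else prod_encode (p1 v, prod_encode (ccons (p1 (p2 v)) (p1 (p2 s)), ctl (p2 (p2 s)))))"

text \<open>A halted configuration is repeated. This makes \<open>run\<close> total, and halting
  shows as a failing lookup.\<close>

definition next_config :: "nat \<Rightarrow> nat \<Rightarrow> nat" where
  "next_config T s =
     (if lookup T (config_key s) = 0 then s else apply_entry (lookup T (config_key s) - 1) s)"

definition run :: "nat \<Rightarrow> nat \<Rightarrow> nat \<Rightarrow> nat" where
  "run T w = rec_nat (prod_encode (0, prod_encode (0, w))) (\<lambda>_. next_config T)"

lemma total_computable_config_key [computable_intros]:
  assumes "total_computable f"
  shows "total_computable (\<lambda>x. config_key (f x))"
  unfolding config_key_def by (intro computable_intros assms)

lemma total_computable_apply_entry [computable_intros]:
  assumes "total_computable f" "total_computable g"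
  shows "total_computable (\<lambda>x. apply_entry (f x) (g x))"
  unfolding apply_entry_def by (intro computable_intros assms)

lemma total_computable_next_config [computable_intros]:
  assumes "total_computable f" "total_computable g"
  shows "total_computable (\<lambda>x. next_config (f x) (g x))"
  unfolding next_config_def by (intro computable_intros assms)

lemma total_computable_run [computable_intros]:
  assumes "total_computable f" "total_computable g" "total_computable h"
  shows "total_computable (\<lambda>x. run (f x) (g x) (h x))"
  unfolding run_def
  by (intro computable_intros assms total_computable_comp[OF assms(1)])

text \<open>A relation rather than a function, since list codes that differ in trailing zeros
  describe the same tape: the default value \<open>0\<close> of \<open>cnth\<close> is the
  blank.\<close>

primrec codes_config :: "nat \<Rightarrow> config \<Rightarrow> bool" where
  "codes_config s (q, ht) \<longleftrightarrow> p1 s = q \<and>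
     (\<forall>i. cnth (p1 (p2 s)) i = snd ht (fst ht - 1 - int i)) \<and>
     (\<forall>i. cnth (p2 (p2 s)) i = snd ht (fst ht + int i))"

lemma codes_config_key:
  assumes "codes_config s (q, h, t)"
  shows "config_key s = prod_encode (q, t h)"
proof -
  have "chd (p2 (p2 s)) = t h" using assms cnth_0[of "p2 (p2 s)"] by (metis add.right_neutral codes_config.simps fst_conv of_nat_0 snd_conv)
  then show ?thesis using assms by (simp add: config_key_def)
qed

lemma codes_config_step:
  assumes "codes_config s c" "tm_step M c = Some c'"
  shows "codes_config (next_config (tm_code M) s) c'"
proof -
  obtain q h t where c: "c = (q, h, t)" by (cases c)
  from assms(2) obtain q' b d where M: "map_of M (q, t h) = Some (q', b, d)"
    and c': "c' = (q', h + offset d, t(h := b))"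
    by (auto simp: c split: option.splits prod.splits)
  define L where "L = p1 (p2 s)"
  define R where "R = p2 (p2 s)"
  have L: "cnth L i = t (h - 1 - int i)" and R: "cnth R i = t (h + int i)" for i
    using assms(1) by (simp_all add: c L_def R_def)
  have cL: "cnth (ctl L) i = t (h - 2 - int i)" and cR: "cnth (ctl R) i = t (h + 1 + int i)" for i
    using L[of "Suc i"] R[of "Suc i"] by (simp_all add: cnth_Suc algebra_simps)
  have hL: "chd L = t (h - 1)" using L[of 0] by (simp add: cnth_0)
  have "next_config (tm_code M) s = apply_entry (prod_encode (q', prod_encode (b, move_code d))) s"
    using codes_config_key[of s q h t] assms(1) by (simp add: next_config_def lookup_tm_code M c)
  also have "codes_config \<dots> c'"
  proof (cases d)
    case Move_Left
    then show ?thesis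
      by (auto simp: c' apply_entry_def cnth_ccons cL cR hL simp flip: L_def R_def split: nat.split)
        (simp_all add: algebra_simps)
  next
    case Move_Right
    then show ?thesis
      by (auto simp: c' apply_entry_def cnth_ccons cR L simp flip: L_def R_def split: nat.split)
        (simp_all add: algebra_simps)
  qed
  finally show ?thesis .
qed

lemma codes_config_halt_iff:
  assumes "codes_config s c"
  shows "lookup (tm_code M) (config_key s) = 0 \<longleftrightarrow> tm_step M c = None"
proof -
  obtain q h t where c: "c = (q, h, t)" by (cases c)
  with assms have "config_key s = prod_encode (q, t h)" using codes_config_key by blast
  then show ?thesis by (simp add: c lookup_tm_code split: option.splits prod.splits)
qed

lemma codes_config_initial:
  "codes_config (prod_encode (0, prod_encode (0, list_encode w))) (initial_config w)"
proof -
  have "cnth 0 i = 0" for i using cnth_list_encode_default[of "[]" i] by simp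
  then show ?thesis by (simp add: initial_config_def cnth_list_encode_default)
qed

declare codes_config.simps [simp del]

lemma halts_on_iff_run: "halts_on M w \<longleftrightarrow>
    (\<exists>n. lookup (tm_code M) (config_key (run (tm_code M) (list_encode w) n)) = 0)"
proof
  assume "halts_on M w"
  then obtain d where d: "(\<lambda>c c'. tm_step M c = Some c')\<^sup>*\<^sup>* (initial_config w) d" "tm_step M d = None"
    unfolding halts_on_def by blast
  from d(1) have "\<exists>n. codes_config (run (tm_code M) (list_encode w) n) d"
  proof (induction rule: rtranclp_induct)
    case base
    show ?case using codes_config_initial by (intro exI[of _ 0]) (simp add: run_def)
  next
    case (step y z)
    then obtain n where "codes_config (run (tm_code M) (list_encode w) n) y" by blast
    from codes_config_step[OF this step(2)] show ?case
      by (intro exI[of _ "Suc n"]) (simp add: run_def)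
  qed
  with d(2) show "\<exists>n. lookup (tm_code M) (config_key (run (tm_code M) (list_encode w) n)) = 0"
    using codes_config_halt_iff by blast
next
  assume "\<exists>n. lookup (tm_code M) (config_key (run (tm_code M) (list_encode w) n)) = 0"
  then obtain n where n: "lookup (tm_code M) (config_key (run (tm_code M) (list_encode w) n)) = 0" ..
  have "\<exists>c. (\<lambda>c c'. tm_step M c = Some c')\<^sup>*\<^sup>* (initial_config w) c \<and>
      codes_config (run (tm_code M) (list_encode w) n) c" for n
  proof (induction n)
    case 0
    have "codes_config (run (tm_code M) (list_encode w) 0) (initial_config w)"
      using codes_config_initial by (simp add: run_def)
    then show ?case by blast
  next
    case (Suc n)
    let ?s = "run (tm_code M) (list_encode w) n"
    obtain c where c: "(\<lambda>c c'. tm_step M c = Some c')\<^sup>*\<^sup>* (initial_config w) c" "codes_config ?s c"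
      using Suc by blast
    have s: "run (tm_code M) (list_encode w) (Suc n) = next_config (tm_code M) ?s"
      by (simp add: run_def)
    show ?case
    proof (cases "tm_step M c")
      case None
      then have "next_config (tm_code M) ?s = ?s"
        using codes_config_halt_iff[OF c(2)] by (simp add: next_config_def)
      then show ?thesis unfolding s using c by (simp only:) blast
    next
      case (Some c')
      then have "(\<lambda>c c'. tm_step M c = Some c')\<^sup>*\<^sup>* (initial_config w) c'"
        using c(1) by (rule rtranclp.rtrancl_into_rtrancl[rotated])
      then show ?thesis unfolding s using codes_config_step[OF c(2) Some] by blast
    qed
  qed
  then obtain c where "(\<lambda>c c'. tm_step M c = Some c')\<^sup>*\<^sup>* (initial_config w) c"
    "codes_config (run (tm_code M) (list_encode w) n) c" by blast
  with n codes_config_halt_iff show "halts_on M w" unfolding halts_on_def by blast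
qed

section \<open>Recognizing codes of machines and input words\<close>

text \<open>A list is no longer than its code, so bounding the position by \<open>l\<close> loses
  nothing and keeps the quantifier computable.\<close>

definition elements :: "(nat \<Rightarrow> bool) \<Rightarrow> nat \<Rightarrow> bool" where
  "elements P l \<longleftrightarrow> (\<forall>i<l. cdrop l i \<noteq> 0 \<longrightarrow> P (cnth l i))"

lemma elements_list_encode: "elements P (list_encode xs) \<longleftrightarrow> (\<forall>x\<in>set xs. P x)"
  unfolding elements_def all_set_conv_all_nth
  using length_le_list_encode[of xs] by (auto simp: cnth_list_encode not_le)

text \<open>Every number codes a list and every number codes a pair, so the move is the only
  component of an entry that can be malformed.\<close>

lemma ex_tm_code_iff: "(\<exists>M. T = tm_code M) \<longleftrightarrow> elements (\<lambda>e. p2 (p2 (p2 e)) \<le> 1) T"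
proof -
  have entry: "p2 (p2 (p2 e)) \<le> 1 \<longleftrightarrow> e \<in> range entry_code" for e
  proof
    assume "p2 (p2 (p2 e)) \<le> 1"
    then obtain d where d: "p2 (p2 (p2 e)) = move_code d"
      by (metis One_nat_def le_Suc_eq le_zero_eq move_code.simps)
    have "e = entry_code ((p1 (p1 e), p2 (p1 e)), (p1 (p2 e), p1 (p2 (p2 e)), d))"
      by (simp flip: d)
    then show "e \<in> range entry_code" by blast
  next
    assume "e \<in> range entry_code"
    then obtain q a q' b d where "e = entry_code ((q, a), (q', b, d))" by auto
    then show "p2 (p2 (p2 e)) \<le> 1" by (cases d) auto
  qed
  have "T = list_encode (list_decode T)" by simp
  then obtain es where T: "T = list_encode es" by blast
  have "(\<exists>M. T = tm_code M) \<longleftrightarrow> (\<exists>M. es = map entry_code M)"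
    by (simp add: T tm_code_def list_encode_eq)
  also have "\<dots> \<longleftrightarrow> set es \<subseteq> range entry_code" unfolding ex_map_conv by blast
  finally show ?thesis unfolding T elements_list_encode entry by blast
qed

lemma semidecidable_halting: "semidecidable (\<lambda>x. x \<in> yes_instances halting_problem)"
proof -
  have "x \<in> yes_instances halting_problem \<longleftrightarrow>
      (elements (\<lambda>e. p2 (p2 (p2 e)) \<le> 1) (p1 x) \<and> elements (\<lambda>a. a \<noteq> 0) (p2 x)) \<and>
      (\<exists>n. lookup (p1 x) (config_key (run (p1 x) (p2 x) n)) = 0)" for x
  proof -
    define T where "T = p1 x"
    define w where "w = list_decode (p2 x)"
    have x: "x = prod_encode (T, list_encode w)" by (simp add: T_def w_def)
    have "x \<in> yes_instances halting_problem \<longleftrightarrow>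
        (\<exists>M. T = tm_code M \<and> 0 \<notin> set w \<and> halts_on M w)"
      by (auto simp: halting_problem_def x list_encode_eq)
    also have "\<dots> \<longleftrightarrow> (\<exists>M. T = tm_code M) \<and> 0 \<notin> set w \<and>
        (\<exists>n. lookup T (config_key (run T (list_encode w) n)) = 0)"
      unfolding halts_on_iff_run by blast
    also have "0 \<notin> set w \<longleftrightarrow> elements (\<lambda>a. a \<noteq> 0) (list_encode w)"
      unfolding elements_list_encode by metis
    finally show ?thesis unfolding ex_tm_code_iff by (simp add: x)
  qed
  moreover have "semidecidable (\<lambda>x.
      (elements (\<lambda>e. p2 (p2 (p2 e)) \<le> 1) (p1 x) \<and> elements (\<lambda>a. a \<noteq> 0) (p2 x)) \<and>
      (\<exists>n. lookup (p1 x) (config_key (run (p1 x) (p2 x) n)) = 0))"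
    unfolding elements_def
    by (intro semidecidable_conj semidecidable_ex semidecidable_computable_pred computable_intros)
  ultimately show ?thesis by simp
qed

section \<open>Semidecidability of the existence of a crossword\<close>

text \<open>Tabulation by primitive recursion has to start with the last entry, because
  \<open>ccons\<close> extends a list at the front.\<close>

lemma list_encode_upt: "list_encode (map f [0..<n]) = rec_nat 0 (\<lambda>k r. ccons (f (n - Suc k)) r) n"
proof -
  have "rec_nat 0 (\<lambda>k r. ccons (f (n - Suc k)) r) k = list_encode (map f [n - k..<n])" if "k \<le> n" for k
    using that
  proof (induction k)
    case (Suc k)
    then have "[n - Suc k..<n] = (n - Suc k) # [n - k..<n]"
      by (simp add: upt_conv_Cons Suc_diff_Suc)
    with Suc show ?case by simp
  qed simp
  from this[of n] show ?thesis by simp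
qed

lemma total_computable_list_encode_upt [computable_intros]:
  assumes "total_computable n" "total_computable (\<lambda>z. f (p1 z) (p2 z))"
  shows "total_computable (\<lambda>x. list_encode (map (\<lambda>j. f j x) [0..<n x]))"
  unfolding list_encode_upt
  by (intro computable_intros assms total_computable_comp[OF assms(1)]
      total_computable_comp2[OF assms(2)])

text \<open>A nondeterministic matcher: a state consists of a stack of expressions, whose concatenation
  has to match the remaining word.\<close>

definition match_step :: "nat \<Rightarrow> nat \<Rightarrow> nat" where
  "match_step s choice = (let st = p1 s; w = p2 s; r = chd st; rest = ctl st in
     if st = 0 then s
     else if p1 r = 0 then prod_encode (rest, w)
     else if p1 r = 1 then if w \<noteq> 0 \<and> chd w = p2 r then prod_encode (rest, ctl w) else s
     else if p1 r = 2 then prod_encode (ccons (if choice = 0 then p1 (p2 r) else p2 (p2 r)) rest, w)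
     else if p1 r = 3 then prod_encode (ccons (p1 (p2 r)) (ccons (p2 (p2 r)) rest), w)
     else if choice = 0 then prod_encode (rest, w)
     else prod_encode (ccons (p2 r) st, w))"

definition match_run :: "nat \<Rightarrow> nat \<Rightarrow> nat \<Rightarrow> nat" where
  "match_run s c = rec_nat s (\<lambda>i s. match_step s (cnth c i))"

text \<open>\<open>c\<close> lists the nondeterministic choices. \<open>0\<close> is the code of the
  accepting state, an empty stack with an empty word.\<close>

definition matches :: "nat \<Rightarrow> nat \<Rightarrow> bool" where
  "matches r w \<longleftrightarrow> (\<exists>c n. match_run (prod_encode (ccons r 0, w)) c n = 0)"

primrec langs :: "nat rexp list \<Rightarrow> nat list set" where
  "langs [] = {[]}"
| "langs (r # rs) = {u @ v | u v. u \<in> lang r \<and> v \<in> langs rs}"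

definition match_state :: "nat rexp list \<Rightarrow> nat list \<Rightarrow> nat" where
  "match_state rs w = prod_encode (list_encode (map rexp_code rs), list_encode w)"

lemma match_step_simps:
  "match_step (match_state [] w) c = match_state [] w"
  "match_step (match_state (Eps # rs) w) c = match_state rs w"
  "match_step (match_state (Letter a # rs) w) c =
     (if w \<noteq> [] \<and> hd w = a then match_state rs (tl w) else match_state (Letter a # rs) w)"
  "match_step (match_state (Plus r1 r2 # rs) w) c = match_state ((if c = 0 then r1 else r2) # rs) w"
  "match_step (match_state (Times r1 r2 # rs) w) c = match_state (r1 # r2 # rs) w"
  "match_step (match_state (Star r # rs) w) c =
     match_state (if c = 0 then rs else r # Star r # rs) w"
  by (cases w; simp add: match_step_def match_state_def Let_def)+

lemma match_state_final: "match_state rs w = 0 \<longleftrightarrow> rs = [] \<and> w = []"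
proof -
  have "prod_encode (0, 0) = 0" by (simp add: prod_encode_def)
  then have "prod_encode (a, b) = 0 \<longleftrightarrow> a = 0 \<and> b = 0" for a b
    by (metis Pair_inject prod_encode_eq)
  then show ?thesis by (simp add: match_state_def)
qed

text \<open>Matching is inherited backwards: whatever the choice, a step never admits a word that
  the old stack excludes. A letter that does not fit leaves the matcher stuck.\<close>

lemma match_step_sound:
  "\<exists>rs' w'. match_step (match_state rs w) c = match_state rs' w' \<and>
     (w' \<in> langs rs' \<longrightarrow> w \<in> langs rs)"
proof (cases rs)
  case Nil
  then show ?thesis by (intro exI[of _ "[]"] exI[of _ w]) (simp add: match_step_simps)
next
  case (Cons r rs0)
  show ?thesis
  proof (cases r)
    case Eps
    then show ?thesis using Cons
      by (intro exI[of _ rs0] exI[of _ w]) (auto simp: match_step_simps)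
  next
    case (Letter a)
    show ?thesis
    proof (cases "w \<noteq> [] \<and> hd w = a")
      case True
      then show ?thesis using Cons Letter
        by (intro exI[of _ rs0] exI[of _ "tl w"]) (cases w; auto simp: match_step_simps)
    next
      case False
      then show ?thesis using Cons Letter
        by (intro exI[of _ rs] exI[of _ w]) (auto simp: match_step_simps)
    qed
  next
    case (Plus r1 r2)
    then show ?thesis using Cons
      by (intro exI[of _ "(if c = 0 then r1 else r2) # rs0"] exI[of _ w])
        (auto simp: match_step_simps)
  next
    case (Times r1 r2)
    then show ?thesis using Cons
      by (intro exI[of _ "r1 # r2 # rs0"] exI[of _ w])
        (auto simp: match_step_simps simp flip: append_assoc, blast)
  next
    case (Star r1)
    show ?thesis
    proof (cases "c = 0")
      case True
      have "[] \<in> lang (Star r1)" by (auto intro!: exI[of _ "[]"])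
      moreover have "w = [] @ w" by simp
      ultimately have "w \<in> langs (Star r1 # rs0)" if "w \<in> langs rs0"
        using that unfolding langs.simps by blast
      then show ?thesis using Cons Star True
        by (intro exI[of _ rs0] exI[of _ w]) (auto simp: match_step_simps)
    next
      case False
      have "w \<in> langs (Star r1 # rs0)" if w: "w \<in> langs (r1 # Star r1 # rs0)"
      proof -
        from w obtain u ws v where "w = u @ concat ws @ v" "u \<in> lang r1" "set ws \<subseteq> lang r1"
          "v \<in> langs rs0" by auto
        then have "w = concat (u # ws) @ v" "set (u # ws) \<subseteq> lang r1" by auto
        with \<open>v \<in> langs rs0\<close> show ?thesis unfolding langs.simps lang.simps by blast
      qed
      then show ?thesis using Cons Star False
        by (intro exI[of _ "r1 # Star r1 # rs0"] exI[of _ w]) (auto simp: match_step_simps)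
    qed
  qed
qed

definition match_rel :: "nat \<Rightarrow> nat \<Rightarrow> bool" where
  "match_rel s s' \<longleftrightarrow> (\<exists>c. s' = match_step s c)"

text \<open>Completeness, with the remaining stack and word left arbitrary, since the expressions
  pushed by \<open>Times\<close> and \<open>Star\<close> are matched in such a context.\<close>

lemma match_rel_lang:
  "u \<in> lang r \<Longrightarrow> match_rel\<^sup>*\<^sup>* (match_state (r # rs) (u @ w)) (match_state rs w)"
proof (induction r arbitrary: u w rs)
  case Eps
  then show ?case by (auto simp: match_rel_def match_step_simps intro: r_into_rtranclp)
next
  case (Letter a)
  then show ?case by (auto simp: match_rel_def match_step_simps intro!: r_into_rtranclp)
next
  case (Plus r1 r2)
  have "match_rel (match_state (Plus r1 r2 # rs) (u @ w)) (match_state (r1 # rs) (u @ w))"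
    unfolding match_rel_def by (rule exI[of _ 0]) (simp add: match_step_simps)
  moreover have "match_rel (match_state (Plus r1 r2 # rs) (u @ w)) (match_state (r2 # rs) (u @ w))"
    unfolding match_rel_def by (rule exI[of _ 1]) (simp add: match_step_simps)
  ultimately show ?case
    using Plus by (auto intro: converse_rtranclp_into_rtranclp)
next
  case (Times r1 r2)
  then obtain u1 u2 where u: "u = u1 @ u2" "u1 \<in> lang r1" "u2 \<in> lang r2" by auto
  have "match_rel (match_state (Times r1 r2 # rs) (u @ w)) (match_state (r1 # r2 # rs) (u1 @ u2 @ w))"
    unfolding match_rel_def by (simp add: match_step_simps u)
  also have "match_rel\<^sup>*\<^sup>* (match_state (r1 # r2 # rs) (u1 @ u2 @ w)) (match_state (r2 # rs) (u2 @ w))"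
    using Times.IH(1) u by blast
  also have "match_rel\<^sup>*\<^sup>* (match_state (r2 # rs) (u2 @ w)) (match_state rs w)"
    using Times.IH(2) u by blast
  finally show ?case .
next
  case (Star r)
  then obtain ws where ws: "u = concat ws" "set ws \<subseteq> lang r" by auto
  have "match_rel\<^sup>*\<^sup>* (match_state (Star r # rs) (concat ws @ w)) (match_state rs w)"
    using ws(2)
  proof (induction ws)
    case Nil
    have "match_rel (match_state (Star r # rs) w) (match_state rs w)"
      unfolding match_rel_def by (rule exI[of _ 0]) (simp add: match_step_simps)
    then show ?case by auto
  next
    case (Cons v ws)
    have "match_rel (match_state (Star r # rs) (concat (v # ws) @ w))
        (match_state (r # Star r # rs) (v @ concat ws @ w))"
      unfolding match_rel_def by (rule exI[of _ 1]) (simp add: match_step_simps)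
    also have "match_rel\<^sup>*\<^sup>* (match_state (r # Star r # rs) (v @ concat ws @ w))
        (match_state (Star r # rs) (concat ws @ w))"
      using Star.IH Cons.prems by simp
    also have "match_rel\<^sup>*\<^sup>* (match_state (Star r # rs) (concat ws @ w)) (match_state rs w)"
      using Cons by simp
    finally show ?case .
  qed
  then show ?case by (simp add: ws(1))
qed

lemma match_rel_run:
  assumes "match_rel\<^sup>*\<^sup>* s s'"
  shows "\<exists>c n. match_run s c n = s'"
proof -
  from assms obtain n where "(match_rel ^^ n) s s'"
    using rtranclp_imp_relpowp[of _ s s'] by blast
  then obtain f where f: "f 0 = s" "f n = s'" "\<And>i. i < n \<Longrightarrow> match_rel (f i) (f (Suc i))"
    unfolding relpowp_fun_conv by blast
  then obtain g where g: "\<And>i. i < n \<Longrightarrow> f (Suc i) = match_step (f i) (g i)"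
    unfolding match_rel_def by metis
  have "match_run s (list_encode (map g [0..<n])) i = f i" if "i \<le> n" for i
    using that by (induction i) (auto simp: match_run_def f(1) g cnth_list_encode)
  then show ?thesis using f(2) by blast
qed

lemma matches_iff: "matches (rexp_code r) (list_encode w) \<longleftrightarrow> w \<in> lang r"
proof -
  have start: "prod_encode (ccons (rexp_code r) 0, list_encode w) = match_state [r] w"
    by (simp add: match_state_def)
  show ?thesis
  proof
    assume "matches (rexp_code r) (list_encode w)"
    then obtain c n where run: "match_run (match_state [r] w) c n = 0"
      unfolding matches_def start by blast
    have "\<exists>rs' w'. match_run (match_state [r] w) c n = match_state rs' w' \<and>
        (w' \<in> langs rs' \<longrightarrow> w \<in> langs [r])" for n
    proof (induction n)
      case 0
      show ?case unfolding match_run_def by (intro exI[of _ "[r]"] exI[of _ w]) auto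
    next
      case (Suc n)
      then obtain rs' w' where "match_run (match_state [r] w) c n = match_state rs' w'"
        "w' \<in> langs rs' \<longrightarrow> w \<in> langs [r]" by blast
      then show ?case
        using match_step_sound[of rs' w' "cnth c n"] by (auto simp: match_run_def)
    qed
    from this[of n] run obtain rs' w' where "match_state rs' w' = 0"
      "w' \<in> langs rs' \<longrightarrow> w \<in> langs [r]" by auto
    then show "w \<in> lang r" by (auto simp: match_state_final)
  next
    assume "w \<in> lang r"
    from match_rel_lang[OF this, of "[]" "[]"] match_rel_run
    obtain c n where "match_run (match_state [r] w) c n = match_state [] []" by fastforce
    then show "matches (rexp_code r) (list_encode w)"
      unfolding matches_def start using match_state_final by metis
  qed
qed

lemma semidecidable_matches:
  assumes "total_computable f" "total_computable g"
  shows "semidecidable (\<lambda>x. matches (f x) (g x))"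
proof -
  have step: "total_computable (\<lambda>z. match_step (p1 z) (p2 z))"
    unfolding match_step_def Let_def by (intro computable_intros)
  have "semidecidable (\<lambda>z. matches (p1 z) (p2 z))"
    unfolding matches_def match_run_def
    by (intro semidecidable_ex semidecidable_computable_pred computable_intros
        total_computable_comp2[OF step])
  from semidecidable_comp[OF this total_computable_basic2(3)[OF assms]] show ?thesis by simp
qed

section \<open>The search for a crossword\<close>

text \<open>The array is a list indexed by \<open>prod_encode (i, j)\<close>. Membership of the
  cells in the alphabet is enforced by the rows, whose words contain only letters of the row
  expression.\<close>

definition coded_crossword_exists :: "nat rexp \<Rightarrow> nat \<Rightarrow> bool" where
  "coded_crossword_exists C x \<longleftrightarrow> (\<exists>m n a. (1 \<le> m \<and> 1 \<le> n) \<and>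
     (\<forall>i<m. matches x (list_encode (map (\<lambda>j. cnth a (prod_encode (i, j))) [0..<n]))) \<and>
     (\<forall>j<n. matches (rexp_code C) (list_encode (map (\<lambda>i. cnth a (prod_encode (i, j))) [0..<m]))))"

lemma semidecidable_coded_crossword_exists: "semidecidable (coded_crossword_exists C)"
  unfolding coded_crossword_exists_def[abs_def]
  by (intro semidecidable_ex semidecidable_conj semidecidable_all_less semidecidable_matches
      semidecidable_computable_pred computable_intros)

lemma lang_letters: "w \<in> lang r \<Longrightarrow> set w \<subseteq> letters r"
proof (induction r arbitrary: w)
  case (Star r)
  then show ?case by fastforce
qed fastforce+

lemma coded_crossword_exists_iff:
  assumes "letters R \<subseteq> \<Sigma>"
  shows "coded_crossword_exists C (rexp_code R) \<longleftrightarrow> (\<exists>m n a. crossword \<Sigma> R C m n a)"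
proof
  assume "coded_crossword_exists C (rexp_code R)"
  then obtain m n a where *: "1 \<le> m" "1 \<le> n"
    "\<And>i. i < m \<Longrightarrow> map (\<lambda>j. cnth a (prod_encode (i, j))) [0..<n] \<in> lang R"
    "\<And>j. j < n \<Longrightarrow> map (\<lambda>i. cnth a (prod_encode (i, j))) [0..<m] \<in> lang C"
    unfolding coded_crossword_exists_def matches_iff by blast
  have "cnth a (prod_encode (i, j)) \<in> \<Sigma>" if "i < m" "j < n" for i j
  proof -
    have "cnth a (prod_encode (i, j)) \<in> set (map (\<lambda>j. cnth a (prod_encode (i, j))) [0..<n])"
      using that(2) by simp
    then show ?thesis using lang_letters[OF *(3)[OF that(1)]] assms by blast
  qed
  with * show "\<exists>m n a. crossword \<Sigma> R C m n a"
    unfolding crossword_def by (intro exI[of _ m] exI[of _ n] exI[of _ "\<lambda>i j. cnth a (prod_encode (i, j))"]) auto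
next
  assume "\<exists>m n a. crossword \<Sigma> R C m n a"
  then obtain m n a where *: "1 \<le> m" "1 \<le> n"
    "\<And>i. i < m \<Longrightarrow> map (\<lambda>j. a i j) [0..<n] \<in> lang R"
    "\<And>j. j < n \<Longrightarrow> map (\<lambda>i. a i j) [0..<m] \<in> lang C"
    unfolding crossword_def by blast
  \<comment> \<open>The list has to reach the largest code of a position in the array.\<close>
  define N where "N = Suc (Max (prod_encode ` ({..<m} \<times> {..<n})))"
  have N: "prod_encode (i, j) < N" if "i < m" "j < n" for i j
    unfolding N_def less_Suc_eq_le using that by (intro Max_ge) auto
  define c where "c = list_encode (map (\<lambda>z. a (p1 z) (p2 z)) [0..<N])"
  have c: "cnth c (prod_encode (i, j)) = a i j" if "i < m" "j < n" for i j
    using N[OF that] by (simp add: c_def cnth_list_encode)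
  have "map (\<lambda>j. cnth c (prod_encode (i, j))) [0..<n] = map (\<lambda>j. a i j) [0..<n]" if "i < m" for i
    using that c by simp
  with *(3) have "map (\<lambda>j. cnth c (prod_encode (i, j))) [0..<n] \<in> lang R" if "i < m" for i
    using that by (simp only:)
  moreover have "map (\<lambda>i. cnth c (prod_encode (i, j))) [0..<m] = map (\<lambda>i. a i j) [0..<m]" if "j < n" for j
    using that c by simp
  with *(4) have "map (\<lambda>i. cnth c (prod_encode (i, j))) [0..<m] \<in> lang C" if "j < n" for j
    using that by (simp only:)
  ultimately show "coded_crossword_exists C (rexp_code R)"
    unfolding coded_crossword_exists_def matches_iff using *(1,2) by blast
qed

section \<open>Counter programs computing recursive functions\<close>

datatype cmd = Inc nat | Dec nat | While nat "cmd list"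

instance cmd :: countable by countable_datatype

text \<open>Small steps, so that infinite runs can be followed as well as terminating ones. The list
  of remaining commands is the whole control state.\<close>

inductive cstep :: "cmd list \<times> (nat \<Rightarrow> nat) \<Rightarrow> cmd list \<times> (nat \<Rightarrow> nat) \<Rightarrow> bool" where
  Inc: "cstep (Inc r # ks, s) (ks, s(r := Suc (s r)))"
| Dec: "cstep (Dec r # ks, s) (ks, s(r := s r - 1))"
| While_end: "s r = 0 \<Longrightarrow> cstep (While r b # ks, s) (ks, s)"
| While_iter: "s r \<noteq> 0 \<Longrightarrow> cstep (While r b # ks, s) (b @ While r b # ks, s)"

text \<open>The arbitrary continuation \<open>ks\<close> lets programs be composed by transitivity
  and used as loop bodies.\<close>

definition exec :: "cmd list \<Rightarrow> (nat \<Rightarrow> nat) \<Rightarrow> (nat \<Rightarrow> nat) \<Rightarrow> bool" where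
  "exec p s s' \<longleftrightarrow> (\<forall>ks. cstep\<^sup>*\<^sup>* (p @ ks, s) (ks, s'))"

lemma exec_Nil: "exec [] s s"
  by (simp add: exec_def)

lemma exec_append: "exec p s s' \<Longrightarrow> exec q s' s'' \<Longrightarrow> exec (p @ q) s s''"
  unfolding exec_def by (metis append_assoc rtranclp_trans)

lemma exec_Cons: "exec [c] s s' \<Longrightarrow> exec q s' s'' \<Longrightarrow> exec (c # q) s s''"
  using exec_append[of "[c]"] by simp

lemma exec_Inc: "exec [Inc r] s (s(r := Suc (s r)))"
  by (auto simp: exec_def intro: cstep.intros)

lemma exec_Dec: "exec [Dec r] s (s(r := s r - 1))"
  by (auto simp: exec_def intro: cstep.Dec[simplified])

lemma exec_While_end: "s r = 0 \<Longrightarrow> exec [While r b] s s"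
  by (auto simp: exec_def intro: cstep.intros)

lemma exec_While_iter:
  assumes "s r \<noteq> 0" "exec b s s'" "exec [While r b] s' s''"
  shows "exec [While r b] s s''"
  unfolding exec_def
proof
  fix ks
  have "cstep ([While r b] @ ks, s) (b @ While r b # ks, s)"
    using assms(1) by (simp add: cstep.While_iter)
  also have "cstep\<^sup>*\<^sup>* (b @ While r b # ks, s) (While r b # ks, s')"
    using assms(2) unfolding exec_def by blast
  also have "cstep\<^sup>*\<^sup>* (While r b # ks, s') (ks, s'')"
    using assms(3) unfolding exec_def by simp
  finally show "cstep\<^sup>*\<^sup>* ([While r b] @ ks, s) (ks, s'')" .
qed

definition clear :: "nat \<Rightarrow> cmd list" where
  "clear r = [While r [Dec r]]"

lemma exec_clear: "exec (clear r) s (s(r := 0))"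
  unfolding clear_def
proof (induction "s r" arbitrary: s)
  case 0
  then show ?case using exec_While_end[of s r] by (metis fun_upd_triv)
next
  case (Suc n)
  from exec_While_iter[OF _ exec_Dec Suc(1)[of "s(r := s r - 1)"]] Suc(2) show ?case
    by simp
qed

lemma exec_clears: "exec (concat (map clear rs)) s (\<lambda>r. if r \<in> set rs then 0 else s r)"
proof (induction rs arbitrary: s)
  case Nil
  then show ?case by (simp add: exec_Nil)
next
  case (Cons r rs)
  have "(\<lambda>r'. if r' \<in> set rs then 0 else (s(r := 0)) r') =
      (\<lambda>r'. if r' \<in> set (r # rs) then 0 else s r')" by auto
  with exec_append[OF exec_clear Cons[of "s(r := 0)"]] show ?case by simp
qed

definition move :: "nat \<Rightarrow> nat \<Rightarrow> cmd list" where
  "move a b = [While a [Dec a, Inc b]]"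

lemma exec_move:
  assumes "a \<noteq> b"
  shows "exec (move a b) s (s(a := 0, b := s b + s a))"
  unfolding move_def
proof (induction "s a" arbitrary: s)
  case 0
  then have eq: "s(a := 0, b := s b + s a) = s" by auto
  show ?case unfolding eq by (rule exec_While_end) (simp add: 0[symmetric])
next
  case (Suc n)
  let ?s = "s(a := s a - 1, b := Suc (s b))"
  have "exec [Dec a, Inc b] s ?s"
    using exec_Cons[OF exec_Dec exec_Inc, of a b s] assms by simp
  moreover have "exec [While a [Dec a, Inc b]] ?s (?s(a := 0, b := ?s b + ?s a))"
    using assms Suc(2) by (intro Suc(1)) simp
  moreover have "?s(a := 0, b := ?s b + ?s a) = s(a := 0, b := s b + s a)"
    using assms Suc(2) by auto
  ultimately show ?case using exec_While_iter[of s a] Suc(2) by simp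
qed

text \<open>Reading a counter destroys it; \<open>t\<close> keeps a second copy from which
  \<open>a\<close> is restored.\<close>

definition copy :: "nat \<Rightarrow> nat \<Rightarrow> nat \<Rightarrow> cmd list" where
  "copy a b t = While a [Dec a, Inc b, Inc t] # move t a"

lemma exec_copy:
  assumes "distinct [a, b, t]" "s t = 0"
  shows "exec (copy a b t) s (s(b := s b + s a))"
proof -
  have "exec [While a [Dec a, Inc b, Inc t]] s (s(a := 0, b := s b + s a, t := s t + s a))" for s
  proof (induction "s a" arbitrary: s)
    case 0
    then have eq: "s(a := 0, b := s b + s a, t := s t + s a) = s" by auto
    show ?case unfolding eq by (rule exec_While_end) (simp add: 0[symmetric])
  next
    case (Suc n)
    let ?s = "s(a := s a - 1, b := Suc (s b), t := Suc (s t))"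
    have "exec [Dec a, Inc b, Inc t] s ?s"
      using exec_Cons[OF exec_Dec exec_Cons[OF exec_Inc exec_Inc], of a b t s] assms by simp
    moreover have "exec [While a [Dec a, Inc b, Inc t]] ?s
        (?s(a := 0, b := ?s b + ?s a, t := ?s t + ?s a))"
      using assms Suc(2) by (intro Suc(1)) simp
    moreover have "?s(a := 0, b := ?s b + ?s a, t := ?s t + ?s a) =
        s(a := 0, b := s b + s a, t := s t + s a)"
      using assms Suc(2) by auto
    ultimately show ?case using exec_While_iter[of s a] Suc(2) by simp
  qed
  from exec_Cons[OF this exec_move[of t a]] assms(1)
  have "exec (copy a b t) s ((s(a := 0, b := s b + s a, t := s t + s a))(t := 0, a := s t + s a))"
    by (simp add: copy_def)
  moreover have "(s(a := 0, b := s b + s a, t := s t + s a))(t := 0, a := s t + s a) =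
      s(b := s b + s a)"
    using assms by auto
  ultimately show ?thesis by simp
qed

section \<open>Compilation of recursive functions\<close>

text \<open>Takes programs instead of functions, since the primitive recursion of
  \<open>compile\<close> reaches the list \<open>gs\<close> only through
  \<open>map compile gs\<close>.\<close>

primrec compile_args ::
    "(nat list \<Rightarrow> nat \<Rightarrow> nat \<Rightarrow> cmd list) list \<Rightarrow> nat list \<Rightarrow> nat \<Rightarrow> nat \<Rightarrow> cmd list" where
  "compile_args [] ins j t = []"
| "compile_args (c # cs) ins j t = c ins j t @ compile_args cs ins (Suc j) t"

text \<open>\<open>compile p ins out t\<close> reads its arguments from the registers \<open>ins\<close>, adds the result to
  the register \<open>out\<close>, and uses the registers from \<open>t\<close> on, initially and finally \<open>0\<close>, as scratch
  space.\<close>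

primrec compile :: "recf \<Rightarrow> nat list \<Rightarrow> nat \<Rightarrow> nat \<Rightarrow> cmd list" where
  "compile Zero = (\<lambda>ins out t. [])"
| "compile Succ = (\<lambda>ins out t. copy (hd ins) out t @ [Inc out])"
| "compile (Proj i) = (\<lambda>ins out t. copy (ins ! i) out t)"
| "compile (Comp f gs) = (\<lambda>ins out t.
     compile_args (map compile gs) ins t (t + length gs) @
     compile f [t..<t + length gs] out (t + length gs) @
     concat (map clear [t..<t + length gs]))"
| "compile (PrimRec f g) = (\<lambda>ins out t.
     copy (hd ins) (t + 1) (t + 3) @ compile f (tl ins) out (t + 3) @
     [While (t + 1) ([Dec (t + 1)] @ compile g (t # out # tl ins) (t + 2) (t + 3) @
        clear out @ move (t + 2) out @ [Inc t])] @
     clear t)"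
| "compile (Mu f) = (\<lambda>ins out t.
     compile f (out # ins) t (t + 1) @
     [While t (clear t @ [Inc out] @ compile f (out # ins) t (t + 1))])"

text \<open>Nothing is claimed where the function is undefined. The one divergence that matters, a
  search with a total test that never succeeds, is followed round by round with
  \<open>exec_Mu_body\<close>.\<close>

definition compile_correct :: "recf \<Rightarrow> bool" where
  "compile_correct p \<longleftrightarrow> (\<forall>ins out t s y.
     computes p (map s ins) y \<longrightarrow> set ins \<subseteq> {..<t} \<longrightarrow> out < t \<longrightarrow> out \<notin> set ins \<longrightarrow>
     s out = 0 \<longrightarrow> (\<forall>r\<ge>t. s r = 0) \<longrightarrow> exec (compile p ins out t) s (s(out := y)))"

lemma compile_correctD:
  assumes "compile_correct p" "computes p xs y" "map s ins = xs" "set ins \<subseteq> {..<t}" "out < t"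
    "out \<notin> set ins" "s out = 0" "\<And>r. r \<ge> t \<Longrightarrow> s r = 0" "s(out := y) = s'"
  shows "exec (compile p ins out t) s s'"
  using assms unfolding compile_correct_def by blast

lemma exec_compile_args:
  assumes "list_all2 (\<lambda>g y. computes g xs y) gs ys" "\<And>g. g \<in> set gs \<Longrightarrow> compile_correct g"
    "map s ins = xs" "set ins \<subseteq> {..<j}" "j + length gs \<le> t" "\<And>r. r \<ge> j \<Longrightarrow> s r = 0"
  shows "exec (compile_args (map compile gs) ins j t) s
           (\<lambda>r. if j \<le> r \<and> r < j + length gs then ys ! (r - j) else s r)"
  using assms
proof (induction arbitrary: j s rule: list_all2_induct)
  case Nil
  have "(\<lambda>r. if j \<le> r \<and> r < j + length [] then [] ! (r - j) else s r) = s" by auto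
  then show ?case using exec_Nil by (simp del: length_0_conv)
next
  case (Cons g gs y ys)
  let ?s = "s(j := y)"
  have "exec (compile g ins j t) s ?s"
    by (rule compile_correctD[of _ xs y]) (use Cons in auto)
  moreover have "exec (compile_args (map compile gs) ins (Suc j) t) ?s
      (\<lambda>r. if Suc j \<le> r \<and> r < Suc j + length gs then ys ! (r - Suc j) else ?s r)"
    by (rule Cons.IH) (use Cons.prems in \<open>auto intro!: map_cong\<close>)
  moreover have "(\<lambda>r. if Suc j \<le> r \<and> r < Suc j + length gs then ys ! (r - Suc j) else ?s r) =
      (\<lambda>r. if j \<le> r \<and> r < j + length (g # gs) then (y # ys) ! (r - j) else s r)"
    by (rule ext) (auto simp: nth_Cons diff_Suc split: nat.split)
  ultimately show ?case by (simp add: exec_append)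
qed

lemma compile_correct_Comp:
  assumes "compile_correct f" "\<And>g. g \<in> set gs \<Longrightarrow> compile_correct g"
  shows "compile_correct (Comp f gs)"
  unfolding compile_correct_def
proof (intro allI impI)
  fix ins :: "nat list" and out t :: nat and s :: "nat \<Rightarrow> nat" and y :: nat
  assume c: "computes (Comp f gs) (map s ins) y" and ins: "set ins \<subseteq> {..<t}" "out < t"
    "out \<notin> set ins" "s out = 0" "\<forall>r\<ge>t. s r = 0"
  from c obtain ys where
    ys: "list_all2 (\<lambda>g y. computes g (map s ins) y) gs ys" "computes f ys y"
    by (rule computes_elims)
  let ?n = "length gs"
  let ?s = "\<lambda>r. if t \<le> r \<and> r < t + ?n then ys ! (r - t) else s r"
  have "exec (compile_args (map compile gs) ins t (t + ?n)) s ?s"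
    by (rule exec_compile_args[OF ys(1)]) (use assms ins in auto)
  moreover have "exec (compile f [t..<t + ?n] out (t + ?n)) ?s (?s(out := y))"
    by (rule compile_correctD[OF assms(1) ys(2)])
      (use list_all2_lengthD[OF ys(1)] ins in \<open>auto intro!: nth_equalityI\<close>)
  moreover have "exec (concat (map clear [t..<t + ?n])) (?s(out := y)) (s(out := y))"
  proof -
    have "(\<lambda>r. if r \<in> set [t..<t + ?n] then 0 else (?s(out := y)) r) = s(out := y)"
      using ins by auto
    then show ?thesis using exec_clears[of "[t..<t + ?n]" "?s(out := y)"] by (simp only:)
  qed
  ultimately show "exec (compile (Comp f gs) ins out t) s (s(out := y))"
    by (simp add: exec_append)
qed

text \<open>The program computes the values in increasing order, so their existence has to be
  extracted from that of the last one.\<close>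

lemma computes_PrimRec_le:
  "computes (PrimRec f g) (n # xs) y \<Longrightarrow> i \<le> n \<Longrightarrow> \<exists>r. computes (PrimRec f g) (i # xs) r"
proof (induction n arbitrary: y)
  case (Suc n)
  show ?case
  proof (cases "i = Suc n")
    case False
    with Suc show ?thesis by (auto elim: computes_elims)
  qed (use Suc in blast)
qed auto

lemma compile_correct_PrimRec:
  assumes f: "compile_correct f" and g: "compile_correct g"
  shows "compile_correct (PrimRec f g)"
  unfolding compile_correct_def
proof (intro allI impI)
  fix ins :: "nat list" and out t :: nat and s :: "nat \<Rightarrow> nat" and y :: nat
  assume c: "computes (PrimRec f g) (map s ins) y" and ins: "set ins \<subseteq> {..<t}" "out < t"
    "out \<notin> set ins" "s out = 0" "\<forall>r\<ge>t. s r = 0"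
  from c have "ins \<noteq> []" by (auto elim: computes.cases)
  then obtain a ins' where ins_eq: "ins = a # ins'" by (cases ins) auto
  define xs where "xs = map s ins'"
  have c': "computes (PrimRec f g) (s a # xs) y"
    using c by (simp add: ins_eq xs_def)
  \<comment> \<open>Register \<open>t\<close> counts the rounds done, \<open>t + 1\<close> the
    rounds left, and \<open>out\<close> holds the current value. Register \<open>t + 2\<close>
    receives the next value before it replaces the old one.\<close>
  define S where "S i m r = s(t := i, t + 1 := m, out := r)" for i m r
  let ?b = "[Dec (t + 1)] @ compile g (t # out # ins') (t + 2) (t + 3) @
        clear out @ move (t + 2) out @ [Inc t]"
  have loop: "exec [While (t + 1) ?b] (S i m r) (S (i + m) 0 y)"
    if "computes (PrimRec f g) (i # xs) r" "computes (PrimRec f g) ((i + m) # xs) y" for i m r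
    using that
  proof (induction m arbitrary: i r)
    case 0
    then have "r = y" by (auto dest: computes_deterministic)
    then show ?case using ins(2) by (auto simp: S_def intro!: exec_While_end)
  next
    case (Suc m)
    from computes_PrimRec_le[OF Suc(3), of "Suc i"] obtain r' where
      r': "computes (PrimRec f g) (Suc i # xs) r'" by auto
    then obtain r'' where "computes (PrimRec f g) (i # xs) r''" and r'': "computes g (i # r'' # xs) r'"
      by (rule computes_elims)
    with Suc(2) have [simp]: "r'' = r" by (auto dest: computes_deterministic)
    have 1: "exec [Dec (t + 1)] (S i (Suc m) r) (S i m r)"
      using exec_Dec[of "t + 1" "S i (Suc m) r"] ins(2) by (simp add: S_def fun_upd_twist)
    have 2: "exec (compile g (t # out # ins') (t + 2) (t + 3)) (S i m r) ((S i m r)(t + 2 := r'))"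
      by (rule compile_correctD[OF g r''])
        (use ins in \<open>auto simp: S_def xs_def ins_eq intro!: map_cong\<close>)
    have 3: "exec (clear out) ((S i m r)(t + 2 := r')) ((S i m 0)(t + 2 := r'))"
      using exec_clear[of out "(S i m r)(t + 2 := r')"] ins(2) by (simp add: S_def fun_upd_twist)
    have 4: "exec (move (t + 2) out) ((S i m 0)(t + 2 := r')) (S i m r')"
    proof -
      have "((S i m 0)(t + 2 := r'))(t + 2 := 0, out := 0 + r') = S i m r'"
        using ins by (auto simp: S_def)
      moreover have "((S i m 0)(t + 2 := r')) out = 0" "((S i m 0)(t + 2 := r')) (t + 2) = r'"
        using ins by (auto simp: S_def)
      ultimately show ?thesis
        using exec_move[of "t + 2" out "(S i m 0)(t + 2 := r')"] ins(2) by simp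
    qed
    have 5: "exec [Inc t] (S i m r') (S (Suc i) m r')"
      using exec_Inc[of t "S i m r'"] ins(2) by (simp add: S_def fun_upd_twist)
    have b: "exec ?b (S i (Suc m) r) (S (Suc i) m r')"
      by (rule exec_append[OF 1 exec_append[OF 2 exec_append[OF 3 exec_append[OF 4 5]]]])
    have "exec [While (t + 1) ?b] (S (Suc i) m r') (S (Suc i + m) 0 y)"
      using Suc.IH[OF r'] Suc.prems(2) by simp
    moreover have "S i (Suc m) r (t + 1) \<noteq> 0" using ins(2) by (simp add: S_def)
    ultimately have "exec [While (t + 1) ?b] (S i (Suc m) r) (S (Suc i + m) 0 y)"
      using b by (rule exec_While_iter[rotated 2])
    then show ?case by simp
  qed
  obtain r where r: "computes (PrimRec f g) (0 # xs) r"
    using computes_PrimRec_le[OF c', of 0] by auto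
  then have fr: "computes f xs r" by (rule computes_elims)
  have 1: "exec (copy a (t + 1) (t + 3)) s (S 0 (s a) 0)"
  proof -
    have "S 0 (s a) 0 = s(t + 1 := s (t + 1) + s a)"
      using ins by (auto simp: S_def)
    then show ?thesis using exec_copy[of a "t + 1" "t + 3" s] ins by (simp add: ins_eq)
  qed
  have 2: "exec (compile f ins' out (t + 3)) (S 0 (s a) 0) (S 0 (s a) r)"
    by (rule compile_correctD[OF f fr])
      (use ins in \<open>auto simp: S_def xs_def ins_eq intro!: map_cong\<close>)
  have 3: "exec [While (t + 1) ?b] (S 0 (s a) r) (S (s a) 0 y)"
    using loop[OF r] c' by simp
  have 4: "exec (clear t) (S (s a) 0 y) (s(out := y))"
  proof -
    have "(S (s a) 0 y)(t := 0) = s(out := y)" using ins by (auto simp: S_def)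
    then show ?thesis by (metis exec_clear)
  qed
  from exec_append[OF 1 exec_append[OF 2 exec_append[OF 3 4]]]
  show "exec (compile (PrimRec f g) ins out t) s (s(out := y))"
    by (simp add: ins_eq)
qed

text \<open>Separate from the correctness of \<open>Mu\<close> because a failing search repeats this
  round forever. The old test value \<open>w\<close> is arbitrary, as it is cleared first.\<close>

lemma exec_Mu_body:
  assumes f: "compile_correct f" and ins: "set ins \<subseteq> {..<t}" "out < t" "out \<notin> set ins"
    "s out = 0" "\<And>r. r \<ge> t \<Longrightarrow> s r = 0"
    and c: "computes f (Suc i # map s ins) v"
  shows "exec (clear t @ [Inc out] @ compile f (out # ins) t (t + 1))
           (s(out := i, t := w)) (s(out := Suc i, t := v))"
proof -
  have 1: "exec (clear t) (s(out := i, t := w)) (s(out := i, t := 0))"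
    using exec_clear[of t "s(out := i, t := w)"] by simp
  have 2: "exec [Inc out] (s(out := i, t := 0)) (s(out := Suc i, t := 0))"
    using exec_Inc[of out "s(out := i, t := 0)"] ins by (simp add: fun_upd_twist)
  have 3: "exec (compile f (out # ins) t (t + 1)) (s(out := Suc i, t := 0)) (s(out := Suc i, t := v))"
    by (rule compile_correctD[OF f c]) (use ins in \<open>auto intro!: map_cong\<close>)
  from exec_append[OF 1 exec_append[OF 2 3]] show ?thesis .
qed

lemma exec_Mu_start:
  assumes f: "compile_correct f" and ins: "set ins \<subseteq> {..<t}" "out < t" "out \<notin> set ins"
    "s out = 0" "\<And>r. r \<ge> t \<Longrightarrow> s r = 0"
    and c: "computes f (0 # map s ins) v"
  shows "exec (compile f (out # ins) t (t + 1)) s (s(out := 0, t := v))"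
  by (rule compile_correctD[OF f c]) (use ins in \<open>auto intro!: map_cong\<close>)

lemma compile_correct_Mu:
  assumes f: "compile_correct f"
  shows "compile_correct (Mu f)"
  unfolding compile_correct_def
proof (intro allI impI)
  fix ins :: "nat list" and out t :: nat and s :: "nat \<Rightarrow> nat" and n :: nat
  assume c: "computes (Mu f) (map s ins) n" and ins: "set ins \<subseteq> {..<t}" "out < t"
    "out \<notin> set ins" "s out = 0" "\<forall>r\<ge>t. s r = 0"
  from c have n: "computes f (n # map s ins) 0"
    and less: "\<forall>i<n. \<exists>y. computes f (i # map s ins) (Suc y)"
    by (rule computes_elims, simp)+
  let ?b = "clear t @ [Inc out] @ compile f (out # ins) t (t + 1)"
  have loop: "exec [While t ?b] (s(out := i, t := v)) (s(out := n))"
    if "computes f (i # map s ins) v" "i \<le> n" for i v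
    using that
  proof (induction "n - i" arbitrary: i v)
    case 0
    then have "v = 0" using computes_deterministic[OF n] by auto
    then have "s(out := i, t := v) = s(out := n)" "(s(out := n)) t = 0"
      using ins 0 by auto
    then show ?case by (simp only:) (rule exec_While_end)
  next
    case (Suc m)
    then obtain v' where v: "v = Suc v'"
      using less by (metis computes_deterministic zero_less_Suc zero_less_diff)
    obtain w where w: "computes f (Suc i # map s ins) w"
      using less n Suc(2) by (metis Suc_lessI zero_less_Suc zero_less_diff)
    have "exec ?b (s(out := i, t := v)) (s(out := Suc i, t := w))"
      by (rule exec_Mu_body[OF f _ _ _ _ _ w]) (use ins in auto)
    moreover have "exec [While t ?b] (s(out := Suc i, t := w)) (s(out := n))"
      by (rule Suc(1)[OF _ w]) (use Suc(2) in auto)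
    ultimately show ?case by (rule exec_While_iter[rotated]) (simp add: v)
  qed
  obtain v where v: "computes f (0 # map s ins) v"
    using n less by (cases n) auto
  have "exec (compile f (out # ins) t (t + 1)) s (s(out := 0, t := v))"
    by (rule exec_Mu_start[OF f _ _ _ _ _ v]) (use ins in auto)
  from exec_append[OF this loop[OF v]]
  show "exec (compile (Mu f) ins out t) s (s(out := n))" by simp
qed

lemma compile_correct: "compile_correct p"
proof (induction p)
  case Zero
  show ?case unfolding compile_correct_def
    by (auto elim!: computes_elims intro: exec_Nil simp: fun_upd_idem)
next
  case Succ
  show ?case unfolding compile_correct_def
  proof (intro allI impI)
    fix ins :: "nat list" and out t :: nat and s :: "nat \<Rightarrow> nat" and y :: nat
    assume "computes Succ (map s ins) y" and *: "set ins \<subseteq> {..<t}" "out < t"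
      "out \<notin> set ins" "s out = 0" "\<forall>r\<ge>t. s r = 0"
    then obtain a where a: "ins = [a]" "y = Suc (s a)" by (auto elim!: computes_elims)
    then have "exec (copy a out t) s (s(out := s a))"
      using exec_copy[of a out t s] * by simp
    from exec_append[OF this exec_Inc[of out]] show "exec (compile Succ ins out t) s (s(out := y))"
      using a by simp
  qed
next
  case (Proj i)
  show ?case unfolding compile_correct_def
  proof (intro allI impI)
    fix ins :: "nat list" and out t :: nat and s :: "nat \<Rightarrow> nat" and y :: nat
    assume "computes (Proj i) (map s ins) y" and *: "set ins \<subseteq> {..<t}" "out < t"
      "out \<notin> set ins" "s out = 0" "\<forall>r\<ge>t. s r = 0"
    then have i: "i < length ins" "y = s (ins ! i)" by (auto elim!: computes_elims)
    then have "ins ! i \<in> set ins" by simp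
    with * have "ins ! i \<noteq> out" "ins ! i < t" by auto
    with exec_copy[of "ins ! i" out t s] * i show "exec (compile (Proj i) ins out t) s (s(out := y))"
      by auto
  qed
qed (simp_all add: compile_correct_Comp compile_correct_PrimRec compile_correct_Mu)

section \<open>Turing machines executing counter programs\<close>

text \<open>A start from which a dead end can be reached is accessible, as determinism leaves no
  other path; an accessible point starts no infinite path.\<close>

lemma deterministic_reach_diverges:
  assumes det: "\<And>x y z. T x y \<Longrightarrow> T x z \<Longrightarrow> y = z"
    and "T\<^sup>*\<^sup>* x d" "\<And>y. \<not> T d y"
    and "T\<^sup>*\<^sup>* x (c 0)" "\<And>n::nat. T\<^sup>+\<^sup>+ (c n) (c (Suc n))"
  shows False
proof -
  have "Wellfounded.accp (\<lambda>y x. T x y) x"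
    using assms(2)
  proof (induction rule: converse_rtranclp_induct)
    case base
    show ?case by (rule accp.intros) (use assms(3) in auto)
  next
    case (step y z)
    show ?case by (rule accp.intros) (use step det in auto)
  qed
  then have "\<not> T\<^sup>*\<^sup>* x (c n)" for n
  proof (induction arbitrary: n rule: accp.induct)
    case (accI x)
    show ?case
    proof
      assume "T\<^sup>*\<^sup>* x (c n)"
      then have "T\<^sup>+\<^sup>+ x (c (Suc n))" using assms(5) by (rule rtranclp_tranclp_tranclp)
      then obtain y where "T x y" "T\<^sup>*\<^sup>* y (c (Suc n))" by (metis tranclpD)
      with accI show False by blast
    qed
  qed
  with assms(4) show False by blast
qed

lemma finite_single_valued_map_of:
  assumes "finite E" "single_valued E"
  shows "\<exists>xs. \<forall>x y. map_of xs x = Some y \<longleftrightarrow> (x, y) \<in> E"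
proof -
  obtain xs where xs: "set xs = E" using finite_list[OF assms(1)] by blast
  have "map_of xs x = Some y" if "(x, y) \<in> E" for x y
    using weak_map_of_SomeI[of x y xs] that xs assms(2)
    by (metis map_of_SomeD single_valuedD)
  then show ?thesis using xs by (metis map_of_SomeD)
qed

text \<open>A control point of a program is the list of the commands that remain to be executed; these are
  the control points of \<open>p\<close> when it is followed by \<open>ks\<close>.\<close>

fun conts :: "cmd list \<Rightarrow> cmd list \<Rightarrow> cmd list set" where
  "conts [] ks = {}"
| "conts (Inc r # p) ks = insert (Inc r # p @ ks) (conts p ks)"
| "conts (Dec r # p) ks = insert (Dec r # p @ ks) (conts p ks)"
| "conts (While r b # p) ks =
     insert (While r b # p @ ks) (conts b (While r b # p @ ks) \<union> conts p ks)"

lemma finite_conts: "finite (conts p ks)"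
  by (induction p ks rule: conts.induct) auto

lemma append_in_conts: "p @ ks \<in> insert ks (conts p ks)"
  by (cases "(p, ks)" rule: conts.cases) auto

lemma conts_closed: "c # ks' \<in> conts p ks \<Longrightarrow> ks' \<in> insert ks (conts p ks)"
  using append_in_conts by (induction p ks rule: conts.induct) (fastforce)+

text \<open>With \<open>conts_closed\<close> this makes the finite set of control points closed
  under \<open>cstep\<close>, so that finitely many machine states suffice.\<close>

lemma conts_closed_While:
  "While r b # ks' \<in> conts p ks \<Longrightarrow> b @ While r b # ks' \<in> conts p ks"
proof (induction p ks rule: conts.induct)
  case (4 r' b' p ks)
  then show ?case using append_in_conts[of b' "While r' b' # p @ ks"] by auto
qed auto

text \<open>\<open>Work\<close> runs right along the track of a register and \<open>Return\<close>
  runs left to the marker. \<open>Erase\<close> is needed because a decrement notices the end of the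
  track one cell too late; meeting the marker instead means that the register was
  \<open>0\<close>.\<close>

datatype tstate = Work "cmd list" | Return "cmd list" | Erase nat "cmd list"

instance tstate :: countable by countable_datatype

text \<open>The cell with index \<open>i \<ge> 0\<close> holds the set of all registers whose value exceeds \<open>i\<close>, and the
  cell \<open>-1\<close> holds the marker \<open>{k}\<close>, where \<open>k\<close> is not a register. An instruction starts and ends
  with the head on the cell \<open>0\<close>.\<close>

fun act :: "nat \<Rightarrow> tstate \<Rightarrow> nat set \<Rightarrow> (tstate \<times> nat set \<times> move) option" where
  "act k (Work []) S = None"
| "act k (Work (Inc r # ks)) S =
     Some (if r \<in> S then (Work (Inc r # ks), S, Move_Right) else (Return ks, insert r S, Move_Left))"
| "act k (Work (Dec r # ks)) S =
     Some (if r \<in> S then (Work (Dec r # ks), S, Move_Right) else (Erase r ks, S, Move_Left))"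
| "act k (Work (While r b # ks)) S =
     Some (Return (if r \<in> S then b @ While r b # ks else ks), S, Move_Left)"
| "act k (Return ks) S =
     Some (if k \<in> S then (Work ks, S, Move_Right) else (Return ks, S, Move_Left))"
| "act k (Erase r ks) S =
     Some (if k \<in> S then (Work ks, S, Move_Right) else (Return ks, S - {r}, Move_Left))"

text \<open>The shift by two keeps the states \<open>0\<close> and \<open>1\<close> free for the
  start.\<close>

definition state_code :: "tstate \<Rightarrow> nat" where
  "state_code z = Suc (Suc (to_nat z))"

text \<open>\<open>Erase\<close> states arise from decrements only; the other control points
  contribute the default \<open>Work []\<close>, which has no transition.\<close>

definition tstates :: "cmd list set \<Rightarrow> tstate set" where
  "tstates K = Work ` K \<union> Return ` K \<union> (\<lambda>c. case c of Dec r # ks \<Rightarrow> Erase r ks | _ \<Rightarrow> Work []) ` K"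

text \<open>The states \<open>0\<close> and \<open>1\<close> write the marker.\<close>

definition simulates :: "tm \<Rightarrow> cmd list set \<Rightarrow> nat \<Rightarrow> cmd list \<Rightarrow> bool" where
  "simulates M K k p \<longleftrightarrow>
     (\<forall>z S z' S' d. z \<in> tstates K \<longrightarrow> S \<subseteq> {..k} \<longrightarrow> act k z S = Some (z', S', d) \<longrightarrow>
        map_of M (state_code z, set_encode S) = Some (state_code z', set_encode S', d)) \<and>
     (\<forall>a\<le>1. map_of M (0, a) = Some (1, a, Move_Left)) \<and>
     map_of M (1, 0) = Some (state_code (Work p), set_encode {k}, Move_Right) \<and>
     (\<forall>a. map_of M (state_code (Work []), a) = None)"

text \<open>Finitely many states and subsets of \<open>{..k}\<close> give a finite graph of
  transitions. It is single-valued because \<open>set_encode\<close> is injective on finite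
  sets.\<close>

lemma ex_simulates:
  assumes "finite K"
  shows "\<exists>M. simulates M K k p"
proof -
  define D where "D = {(z, S). z \<in> tstates K \<and> S \<subseteq> {..k} \<and> act k z S \<noteq> None}"
  define entry where "entry = (\<lambda>(z, S). case the (act k z S) of (z', S', d) \<Rightarrow>
     ((state_code z, set_encode S), (state_code z', set_encode S', d)))"
  define E where "E = entry ` D \<union> {((0, 0), (1, 0, Move_Left)), ((0, 1), (1, 1, Move_Left)),
     ((1, 0), (state_code (Work p), set_encode {k}, Move_Right))}"
  have "D \<subseteq> tstates K \<times> Pow {..k}" by (auto simp: D_def)
  moreover have "finite (tstates K)" using assms by (simp add: tstates_def)
  ultimately have "finite E" unfolding E_def by (simp add: finite_subset)
  moreover have code: "set_encode S = set_encode S' \<longleftrightarrow> S = S'"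
    if "S \<subseteq> {..k}" "S' \<subseteq> {..k}" for S S'
    using that by (metis finite_atMost finite_subset set_encode_inverse)
  then have "single_valued E"
    unfolding single_valued_def E_def
    by (auto simp: entry_def D_def state_code_def code split: prod.splits)
  ultimately obtain M where M: "\<And>x y. map_of M x = Some y \<longleftrightarrow> (x, y) \<in> E"
    using finite_single_valued_map_of by metis
  have "map_of M (state_code (Work []), a) = None" for a
  proof (rule ccontr)
    assume "map_of M (state_code (Work []), a) \<noteq> None"
    then obtain y where "((state_code (Work []), a), y) \<in> E" using M by blast
    then show False by (auto simp: E_def entry_def D_def state_code_def split: prod.splits)
  qed
  moreover have "map_of M (state_code z, set_encode S) = Some (state_code z', set_encode S', d)"
    if "z \<in> tstates K" "S \<subseteq> {..k}" "act k z S = Some (z', S', d)" for z S z' S' d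
  proof -
    have "(z, S) \<in> D" using that by (simp add: D_def)
    moreover have "entry (z, S) = ((state_code z, set_encode S), (state_code z', set_encode S', d))"
      using that by (simp add: entry_def)
    ultimately show ?thesis unfolding M E_def by (metis UnI1 imageI)
  qed
  moreover have "map_of M (0, a) = Some (1, a, Move_Left)" if "a \<le> 1" for a
    unfolding M E_def using that by (auto simp: le_Suc_eq)
  moreover have "map_of M (1, 0) = Some (state_code (Work p), set_encode {k}, Move_Right)"
    unfolding M E_def by simp
  ultimately have "simulates M K k p" unfolding simulates_def by blast
  then show ?thesis ..
qed

section \<open>Machine runs for single commands and for whole programs\<close>

definition cell :: "nat \<Rightarrow> (nat \<Rightarrow> nat) \<Rightarrow> int \<Rightarrow> nat set" where
  "cell k s i = (if i = - 1 then {k} else if i < 0 then {} else {r. r < k \<and> i < int (s r)})"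

definition tape :: "nat \<Rightarrow> (nat \<Rightarrow> nat) \<Rightarrow> int \<Rightarrow> nat" where
  "tape k s i = set_encode (cell k s i)"

lemma cell_subset: "cell k s i \<subseteq> {..k}"
  by (auto simp: cell_def)

lemma tape_upd: "(\<And>j. cell k s' j = (if j = i then S else cell k s j)) \<Longrightarrow>
    (tape k s)(i := set_encode S) = tape k s'"
  by (rule ext) (simp add: tape_def)

declare tm_step.simps [simp del]

context
  fixes M K k p
  assumes sim: "simulates M K k p"
    and closed: "\<And>c ks. c # ks \<in> K \<Longrightarrow> ks \<in> K"
      "\<And>r b ks. While r b # ks \<in> K \<Longrightarrow> b @ While r b # ks \<in> K"
    and regs: "\<And>r ks. Inc r # ks \<in> K \<Longrightarrow> r < k" "\<And>r ks. Dec r # ks \<in> K \<Longrightarrow> r < k"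
      "\<And>r b ks. While r b # ks \<in> K \<Longrightarrow> r < k"
begin

abbreviation T where "T \<equiv> (\<lambda>c c'. tm_step M c = Some c')"

lemma T_act:
  assumes "z \<in> tstates K" "act k z (cell k s h) = Some (z', S', d)"
  shows "T (state_code z, h, tape k s) (state_code z', h + offset d, (tape k s)(h := set_encode S'))"
proof -
  have "map_of M (state_code z, set_encode (cell k s h)) = Some (state_code z', set_encode S', d)"
    using sim assms cell_subset unfolding simulates_def by blast
  then show ?thesis by (simp add: tape_def tm_step.simps)
qed

lemma T_act_keep:
  assumes "z \<in> tstates K" "act k z (cell k s h) = Some (z', cell k s h, d)"
  shows "T (state_code z, h, tape k s) (state_code z', h + offset d, tape k s)"
  using T_act[OF assms] by (simp add: fun_upd_idem tape_def)

lemma Return_run: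
  assumes "ks \<in> K"
  shows "T\<^sup>+\<^sup>+ (state_code (Return ks), int j - 1, tape k s) (state_code (Work ks), 0, tape k s)"
proof (induction j)
  case 0
  have "T (state_code (Return ks), -1, tape k s) (state_code (Work ks), -1 + offset Move_Right, tape k s)"
    by (rule T_act_keep) (use assms in \<open>auto simp: cell_def tstates_def\<close>)
  then show ?case by auto
next
  case (Suc j)
  have "T (state_code (Return ks), int j, tape k s) (state_code (Return ks), int j + offset Move_Left, tape k s)"
    by (rule T_act_keep) (use assms in \<open>auto simp: cell_def tstates_def\<close>)
  then have "T (state_code (Return ks), int (Suc j) - 1, tape k s) (state_code (Return ks), int j - 1, tape k s)"
    by simp
  then show ?case using Suc by (rule tranclp_into_tranclp2)
qed

text \<open>The cell \<open>s r\<close> is the first one from \<open>0\<close> on that lacks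
  \<open>r\<close>, so adding \<open>r\<close> there increments the register.\<close>

lemma Work_Inc_run:
  assumes K: "Inc r # ks \<in> K" and "j \<le> s r"
  shows "T\<^sup>+\<^sup>+ (state_code (Work (Inc r # ks)), int j, tape k s)
           (state_code (Return ks), int (s r) - 1, tape k (s(r := Suc (s r))))"
  using assms(2)
proof (induction rule: inc_induct)
  case base
  have "T (state_code (Work (Inc r # ks)), int (s r), tape k s)
      (state_code (Return ks), int (s r) + offset Move_Left,
        (tape k s)(int (s r) := set_encode (insert r (cell k s (int (s r))))))"
    by (rule T_act) (use K in \<open>auto simp: cell_def tstates_def\<close>)
  moreover have "(tape k s)(int (s r) := set_encode (insert r (cell k s (int (s r))))) =
      tape k (s(r := Suc (s r)))"
    by (rule tape_upd) (use regs(1)[OF K] in \<open>auto simp: cell_def\<close>)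
  ultimately have "T (state_code (Work (Inc r # ks)), int (s r), tape k s)
      (state_code (Return ks), int (s r) - 1, tape k (s(r := Suc (s r))))"
    by simp
  then show ?case by (rule tranclp.r_into_trancl)
next
  case (step j)
  have "T (state_code (Work (Inc r # ks)), int j, tape k s)
      (state_code (Work (Inc r # ks)), int j + offset Move_Right, tape k s)"
    by (rule T_act_keep) (use K regs(1)[OF K] step in \<open>auto simp: cell_def tstates_def\<close>)
  then have "T (state_code (Work (Inc r # ks)), int j, tape k s)
      (state_code (Work (Inc r # ks)), int (Suc j), tape k s)"
    by (simp add: add.commute)
  then show ?case using step.IH by (rule tranclp_into_tranclp2)
qed

lemma Work_Dec_run:
  assumes K: "Dec r # ks \<in> K" and "j \<le> s r"
  shows "T\<^sup>+\<^sup>+ (state_code (Work (Dec r # ks)), int j, tape k s)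
           (state_code (Erase r ks), int (s r) - 1, tape k s)"
  using assms(2)
proof (induction rule: inc_induct)
  case base
  have "T (state_code (Work (Dec r # ks)), int (s r), tape k s)
      (state_code (Erase r ks), int (s r) + offset Move_Left, tape k s)"
    by (rule T_act_keep) (use K in \<open>auto simp: cell_def tstates_def\<close>)
  then show ?case by auto
next
  case (step j)
  have "T (state_code (Work (Dec r # ks)), int j, tape k s)
      (state_code (Work (Dec r # ks)), int j + offset Move_Right, tape k s)"
    by (rule T_act_keep) (use K regs(2)[OF K] step in \<open>auto simp: cell_def tstates_def\<close>)
  then have "T (state_code (Work (Dec r # ks)), int j, tape k s)
      (state_code (Work (Dec r # ks)), int (Suc j), tape k s)"
    by (simp add: add.commute)
  then show ?case using step.IH by (rule tranclp_into_tranclp2)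
qed

lemma Erase_run:
  assumes K: "Dec r # ks \<in> K"
  shows "T\<^sup>+\<^sup>+ (state_code (Erase r ks), int (s r) - 1, tape k s)
           (state_code (Work ks), 0, tape k (s(r := s r - 1)))"
proof -
  have z: "Erase r ks \<in> tstates K" using K unfolding tstates_def by force
  show ?thesis
  proof (cases "s r")
    case 0
    have "T (state_code (Erase r ks), -1, tape k s) (state_code (Work ks), -1 + offset Move_Right, tape k s)"
      by (rule T_act_keep) (use z in \<open>auto simp: cell_def\<close>)
    moreover have "s(r := s r - 1) = s" using 0 by auto
    ultimately show ?thesis using 0 by auto
  next
    case (Suc n)
    have "T (state_code (Erase r ks), int n, tape k s)
        (state_code (Return ks), int n + offset Move_Left,
          (tape k s)(int n := set_encode (cell k s (int n) - {r})))"
      by (rule T_act) (use z in \<open>auto simp: cell_def\<close>)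
    moreover have "(tape k s)(int n := set_encode (cell k s (int n) - {r})) = tape k (s(r := s r - 1))"
      by (rule tape_upd) (use Suc in \<open>auto simp: cell_def\<close>)
    ultimately have "T (state_code (Erase r ks), int (s r) - 1, tape k s)
        (state_code (Return ks), int n - 1, tape k (s(r := s r - 1)))"
      using Suc by simp
    then show ?thesis using Return_run[OF closed(1)[OF K]] by (rule tranclp_into_tranclp2)
  qed
qed

text \<open>The transitive closure is not reflexive here: each command costs at least one machine
  step, so an infinite run of the program stays infinite.\<close>

lemma cstep_run:
  assumes "cstep (c, s) (c', s')" "c \<in> K"
  shows "c' \<in> K \<and> T\<^sup>+\<^sup>+ (state_code (Work c), 0, tape k s) (state_code (Work c'), 0, tape k s')"
  using assms(1)
proof cases
  case (Inc r)
  then show ?thesis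
    using Work_Inc_run[of r c' 0 s] Return_run[of c' "s r"] closed(1) assms(2)
    by (auto intro: tranclp_trans)
next
  case (Dec r)
  then show ?thesis
    using Work_Dec_run[of r c' 0 s] Erase_run[of r c' s] closed(1) assms(2)
    by (auto intro: tranclp_trans)
next
  case (While_end r b)
  \<comment> \<open>Every transition moves the head, so even a loop test has to step onto the marker
    and come back to the cell \<open>0\<close>.\<close>
  have "T (state_code (Work c), 0, tape k s) (state_code (Return c'), 0 + offset Move_Left, tape k s)"
    by (rule T_act_keep) (use While_end assms(2) in \<open>auto simp: cell_def tstates_def\<close>)
  then show ?thesis
    using Return_run[of c' 0 s] closed(1) While_end assms(2) by (auto intro: tranclp_into_tranclp2)
next
  case (While_iter r b ks)
  have "T (state_code (Work c), 0, tape k s) (state_code (Return c'), 0 + offset Move_Left, tape k s)"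
    by (rule T_act_keep)
      (use While_iter assms(2) regs(3)[of r b ks] in \<open>auto simp: cell_def tstates_def\<close>)
  then show ?thesis
    using Return_run[of c' 0 s] closed(2)[of r b ks] While_iter assms(2)
    by (auto intro: tranclp_into_tranclp2)
qed

lemma csteps_run:
  assumes "cstep\<^sup>*\<^sup>* (c, s) (c', s')" "c \<in> K"
  shows "c' \<in> K \<and> T\<^sup>*\<^sup>* (state_code (Work c), 0, tape k s) (state_code (Work c'), 0, tape k s')"
proof -
  have "fst y \<in> K \<and> T\<^sup>*\<^sup>* (state_code (Work c), 0, tape k s) (state_code (Work (fst y)), 0, tape k (snd y))"
    if "cstep\<^sup>*\<^sup>* (c, s) y" for y
    using that
  proof (induction rule: rtranclp_induct)
    case (step y z)
    then show ?case using cstep_run[of "fst y" "snd y" "fst z" "snd z"]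
      by (auto dest: tranclp_into_rtranclp)
  qed (simp add: assms(2))
  from this[OF assms(1)] show ?thesis by simp
qed

lemma csteps_run_strict:
  assumes "cstep\<^sup>+\<^sup>+ (c, s) (c', s')" "c \<in> K"
  shows "T\<^sup>+\<^sup>+ (state_code (Work c), 0, tape k s) (state_code (Work c'), 0, tape k s')"
proof -
  from assms(1) obtain d t where "cstep (c, s) (d, t)" "cstep\<^sup>*\<^sup>* (d, t) (c', s')"
    by (metis prod.collapse tranclpD)
  then show ?thesis using cstep_run csteps_run assms(2) by (meson tranclp_rtranclp_tranclp)
qed

text \<open>The codes are chosen to fit: \<open>set_encode {}\<close> is \<open>0\<close>, the
  blank, and \<open>set_encode {0}\<close> is \<open>1\<close>. A unary input is therefore already
  the track of register \<open>0\<close>, and only the marker has to be written.\<close>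

lemma initial_run:
  assumes "0 < k"
  shows "T\<^sup>*\<^sup>* (initial_config (replicate x 1)) (state_code (Work p), 0, tape k ((\<lambda>_. 0)(0 := x)))"
proof -
  define t :: "int \<Rightarrow> nat" where "t = (\<lambda>i. if 0 \<le> i \<and> i < int x then 1 else 0)"
  note tm_step.simps [simp]
  have init: "initial_config (replicate x 1) = (0, 0, t)"
    by (auto simp: initial_config_def t_def fun_eq_iff)
  have "t 0 \<le> 1" by (simp add: t_def)
  with sim have "T (0, 0, t) (1, -1, t)" by (simp add: simulates_def)
  moreover have "T (1, -1, t) (state_code (Work p), 0, t(-1 := set_encode {k}))"
    using sim by (simp add: simulates_def t_def)
  moreover have "t(-1 := set_encode {k}) = tape k ((\<lambda>_. 0)(0 := x))"
  proof
    fix i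
    have "cell k ((\<lambda>_. 0)(0 := x)) i = {0}" if "0 \<le> i" "i < int x"
      using that assms by (auto simp: cell_def split: if_splits)
    moreover have "cell k ((\<lambda>_. 0)(0 := x)) i = {}" if "i \<noteq> -1" "i < 0 \<or> i \<ge> int x"
      using that by (auto simp: cell_def split: if_splits)
    moreover have "cell k ((\<lambda>_. 0)(0 := x)) (- 1) = {k}" by (simp add: cell_def)
    moreover have "set_encode {0} = 1" by (simp add: set_encode_def)
    ultimately show "(t(-1 := set_encode {k})) i = tape k ((\<lambda>_. 0)(0 := x)) i"
      by (cases "i = - 1"; cases "0 \<le> i \<and> i < int x") (auto simp: t_def tape_def)
  qed
  ultimately show ?thesis unfolding init by (simp add: converse_rtranclp_into_rtranclp)
qed

lemma halts_on_if_exec: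
  assumes "0 < k" "p \<in> K" "cstep\<^sup>*\<^sup>* (p, (\<lambda>_. 0)(0 := x)) ([], s)"
  shows "halts_on M (replicate x 1)"
proof -
  have "T\<^sup>*\<^sup>* (initial_config (replicate x 1)) (state_code (Work []), 0, tape k s)"
    using initial_run[OF assms(1)] csteps_run[OF assms(3,2)] by (meson rtranclp_trans)
  moreover have "tm_step M (state_code (Work []), 0, tape k s) = None"
    using sim by (simp add: simulates_def tm_step.simps)
  ultimately show ?thesis unfolding halts_on_def by blast
qed

text \<open>Divergence is given as infinitely many returns to one control point \<open>c\<close>,
  with stores \<open>f n\<close>.\<close>

lemma not_halts_on_if_diverges:
  assumes "0 < k" "p \<in> K" "cstep\<^sup>*\<^sup>* (p, (\<lambda>_. 0)(0 := x)) (c, f 0)"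
    and "\<And>n::nat. cstep\<^sup>+\<^sup>+ (c, f n) (c, f (Suc n))"
  shows "\<not> halts_on M (replicate x 1)"
proof
  assume "halts_on M (replicate x 1)"
  then obtain d where d: "T\<^sup>*\<^sup>* (initial_config (replicate x 1)) d" "tm_step M d = None"
    unfolding halts_on_def by blast
  have c: "c \<in> K" using csteps_run[OF assms(3,2)] ..
  show False
  proof (rule deterministic_reach_diverges[OF _ d(1)])
    show "T\<^sup>*\<^sup>* (initial_config (replicate x 1)) (state_code (Work c), 0, tape k (f 0))"
      using initial_run[OF assms(1)] csteps_run[OF assms(3,2)] by (meson rtranclp_trans)
    show "T\<^sup>+\<^sup>+ (state_code (Work c), 0, tape k (f n)) (state_code (Work c), 0, tape k (f (Suc n)))" for n
      using assms(4) c by (rule csteps_run_strict)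
  qed (use d(2) in auto)
qed

end

lemma exec_cstep: "exec p s s' \<Longrightarrow> cstep\<^sup>*\<^sup>* (p, s) ([], s')"
  unfolding exec_def by (metis append_Nil2)

section \<open>Machines that halt exactly on a semidecidable set\<close>

text \<open>The machine searches for a witness with \<open>Mu\<close>. As every single test is
  total, the search either ends or goes round its loop forever.\<close>

theorem semidecidable_imp_halts_on:
  assumes "semidecidable P"
  shows "\<exists>M. \<forall>x. halts_on M (replicate x 1) \<longleftrightarrow> P x"
proof -
  from assms obtain Q where Q: "computable_pred Q" "\<And>x. P x \<longleftrightarrow> (\<exists>n. Q (prod_encode (n, x)))"
    unfolding semidecidable_def by blast
  \<comment> \<open>\<open>Mu\<close> looks for the value \<open>0\<close>, hence the negated
    test.\<close>
  have "rec_fun 2 (\<lambda>xs. of_bool (\<not> Q (prod_encode (xs ! 0, xs ! 1))))"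
    by (rule rec_fun_comp1[of "\<lambda>z. of_bool (\<not> Q z)"])
      (use computable_pred_not[OF Q(1)] in \<open>auto simp: computable_pred_def total_computable_iff
         intro!: rec_fun_prod_encode rec_fun_proj\<close>)
  then obtain q where
    q: "\<And>n x. computes q [n, x] (of_bool (\<not> Q (prod_encode (n, x))))"
    unfolding rec_fun_def
    by (metis (no_types, lifting) One_nat_def length_Cons list.size(3) nth_Cons_0 nth_Cons_Suc
        numeral_2_eq_2)
  \<comment> \<open>The loop body that \<open>compile\<close> produces for \<open>Mu q\<close>; a
    failing search keeps coming back to \<open>[While 2 b]\<close>.\<close>
  define b where "b = clear 2 @ [Inc 1] @ compile q [1, 0] 2 (2 + 1)"
  define p where "p = compile (Mu q) [0] 1 2"
  have p: "p = compile q [1, 0] 2 (2 + 1) @ [While 2 b]" by (simp add: p_def b_def)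
  define K where "K = insert [] (conts p [])"
  \<comment> \<open>Larger than the register of every command that can be executed, so
    \<open>k\<close> is free to serve as the marker.\<close>
  define k where "k = Suc (Max ((\<lambda>c. case c of Inc r # _ \<Rightarrow> r | Dec r # _ \<Rightarrow> r | While r _ # _ \<Rightarrow> r
     | [] \<Rightarrow> 0) ` K))"
  have fin: "finite K" by (simp add: K_def finite_conts)
  have regs: "(case c of Inc r # _ \<Rightarrow> r | Dec r # _ \<Rightarrow> r | While r _ # _ \<Rightarrow> r | [] \<Rightarrow> 0) < k"
    if "c \<in> K" for c
    unfolding k_def less_Suc_eq_le by (rule Max_ge) (use fin that in auto)
  have pK: "p \<in> K" using append_in_conts[of p "[]"] by (simp add: K_def)
  obtain M where M: "simulates M K k p" using ex_simulates[OF fin] by blast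
  have closed: "\<And>c ks. c # ks \<in> K \<Longrightarrow> ks \<in> K"
    "\<And>r b ks. While r b # ks \<in> K \<Longrightarrow> b @ While r b # ks \<in> K"
    using conts_closed[of _ _ p "[]"] conts_closed_While[of _ _ _ p "[]"] by (auto simp: K_def)
  have regs': "\<And>r ks. Inc r # ks \<in> K \<Longrightarrow> r < k" "\<And>r ks. Dec r # ks \<in> K \<Longrightarrow> r < k"
      "\<And>r b ks. While r b # ks \<in> K \<Longrightarrow> r < k"
    using regs by force+
  have "halts_on M (replicate x 1) \<longleftrightarrow> P x" for x
  proof
    assume "P x"
    then obtain n where n: "Q (prod_encode (n, x))" using Q(2) by blast
    define m where "m = (LEAST n. Q (prod_encode (n, x)))"
    have "computes (Mu q) [x] m"
    proof (rule computes.Mu)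
      show "computes q (m # [x]) 0"
        using q[of m x] LeastI[of "\<lambda>n. Q (prod_encode (n, x))", OF n] by (simp add: m_def)
      show "\<forall>i<m. \<exists>y. computes q (i # [x]) (Suc y)"
        using q[of _ x] not_less_Least[of _ "\<lambda>n. Q (prod_encode (n, x))"]
        by (metis One_nat_def m_def of_bool_eq_1_iff)
    qed
    then have "exec p ((\<lambda>_. 0)(0 := x)) ((\<lambda>_. 0)(0 := x, 1 := m))"
      unfolding p_def by (intro compile_correctD[OF compile_correct]) auto
    then show "halts_on M (replicate x 1)"
      by (intro halts_on_if_exec[OF M closed regs' _ pK exec_cstep]) (auto simp: k_def)
  next
    show "halts_on M (replicate x 1) \<Longrightarrow> P x"
    proof (rule ccontr)
      assume halts: "halts_on M (replicate x 1)" and "\<not> P x"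
      then have "\<not> Q (prod_encode (n, x))" for n using Q(2) by blast
      then have q1: "computes q [n, x] 1" for n using q[of n x] by simp
      let ?s = "(\<lambda>_. 0)(0 := x) :: nat \<Rightarrow> nat"
      \<comment> \<open>The store at the loop test: candidate \<open>n\<close> in register
        \<open>1\<close>, and in register \<open>2\<close> the value \<open>1\<close> of the failed
        test.\<close>
      define f where "f n = ?s(1 := n, 2 := 1)" for n
      have "exec (compile q [1, 0] 2 (2 + 1)) ?s (f 0)"
        unfolding f_def by (rule exec_Mu_start[OF compile_correct]) (use q1[of 0] in auto)
      then have "cstep\<^sup>*\<^sup>* (p, ?s) ([While 2 b], f 0)"
        unfolding p exec_def by blast
      moreover have "cstep\<^sup>+\<^sup>+ ([While 2 b], f n) ([While 2 b], f (Suc n))" for n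
      proof -
        have "cstep ([While 2 b], f n) (b @ [While 2 b], f n)"
          by (rule cstep.While_iter) (simp add: f_def)
        moreover have "exec b (f n) (f (Suc n))"
          unfolding f_def b_def by (rule exec_Mu_body[OF compile_correct]) (use q1[of "Suc n"] in auto)
        ultimately show ?thesis unfolding exec_def by (meson rtranclp_into_tranclp2)
      qed
      ultimately have "\<not> halts_on M (replicate x 1)"
        by (intro not_halts_on_if_diverges[OF M closed regs' _ pK]) (auto simp: k_def)
      with halts show False by blast
    qed
  qed
  then show ?thesis by blast
qed

section \<open>The reductions\<close>

lemma total_computable_list_encode_replicate:
  "total_computable (\<lambda>x. list_encode (replicate x 1))"
proof -
  have "total_computable (\<lambda>x. list_encode (map (\<lambda>_. 1) [0..<x]))"
    by (intro computable_intros)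
  then show ?thesis by (simp add: map_replicate_const)
qed

text \<open>With \<open>M\<close> fixed, all summands except the initial row are constants, and the
  only part of that row that varies with \<open>x\<close> is \<open>ones x\<close>, a primitive
  recursion.\<close>

lemma total_computable_row_rexp: "total_computable (\<lambda>x. rexp_code (row_rexp M x))"
proof -
  have ones: "rexp_code (ones x) = rec_nat (rexp_code Eps) (\<lambda>_ r. prod_encode (3,
      prod_encode (rexp_code (Letter (prod_encode (0, plain 1))), r))) x" for x
    by (induction x) auto
  have init: "total_computable (\<lambda>x. rexp_code (initial_row x))"
    unfolding initial_row_def rexp_code.simps(4) ones by (intro computable_intros)
  have "total_computable (\<lambda>x. rexp_code (foldr Plus rs (initial_row x)))" for rs
  proof (induction rs)
    case Nil
    then show ?case using init by simp
  next
    case (Cons r rs)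
    have "total_computable (\<lambda>x. prod_encode (2, prod_encode (rexp_code r,
        rexp_code (foldr Plus rs (initial_row x)))))"
      by (intro computable_intros Cons)
    then show ?case by simp
  qed
  then show ?thesis unfolding row_rexp_def .
qed

lemma row_rexp_instance:
  "rexp_code (row_rexp M x) \<in> instances (crossword_problem (alphabet M) (column_rexp M))"
  unfolding crossword_problem_def decision_problem.sel using letters_row_rexp plural_row_column by blast

lemma row_rexp_yes_instance_iff:
  "rexp_code (row_rexp M x) \<in> yes_instances (crossword_problem (alphabet M) (column_rexp M)) \<longleftrightarrow>
     halts_on M (replicate (Suc x) 1)"
proof -
  have "rexp_code (row_rexp M x) \<in> yes_instances (crossword_problem (alphabet M) (column_rexp M)) \<longleftrightarrow>
      (\<exists>m n a. crossword (alphabet M) (row_rexp M x) (column_rexp M) m n a)"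
    using letters_row_rexp plural_row_column
    by (auto simp: crossword_problem_def inj_eq[OF inj_rexp_code])
  then show ?thesis using crossword_imp halts_imp_crossword by blast
qed

text \<open>One fixed machine searches for a crossword, and the instance is only its unary input.
  This works for every alphabet and every column expression.\<close>

lemma crossword_reducible_to_halting:
  "many_one_reducible (crossword_problem \<Sigma> C) halting_problem"
proof -
  obtain M where M: "\<And>x. halts_on M (replicate x 1) \<longleftrightarrow> coded_crossword_exists C x"
    using semidecidable_imp_halts_on[OF semidecidable_coded_crossword_exists] by blast
  let ?f = "\<lambda>x. prod_encode (tm_code M, list_encode (replicate x 1))"
  have "total_computable ?f"
    by (intro computable_intros total_computable_list_encode_replicate)
  moreover have "?f x \<in> instances halting_problem" for x
    by (simp add: halting_problem_def)
  moreover have "?f x \<in> yes_instances halting_problem \<longleftrightarrow> coded_crossword_exists C x" for x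
    by (auto simp: halting_problem_def list_encode_eq inj_eq[OF inj_tm_code] simp flip: M)
  moreover have "x \<in> yes_instances (crossword_problem \<Sigma> C) \<longleftrightarrow> coded_crossword_exists C x"
    if instance_x: "x \<in> instances (crossword_problem \<Sigma> C)" for x
  proof -
    from instance_x obtain R where R: "x = rexp_code R" "letters R \<subseteq> \<Sigma>" "plural \<Sigma> R C"
      by (auto simp: crossword_problem_def)
    then have "x \<in> yes_instances (crossword_problem \<Sigma> C) \<longleftrightarrow> (\<exists>m n a. crossword \<Sigma> R C m n a)"
      by (auto simp: crossword_problem_def inj_eq[OF inj_rexp_code])
    then show ?thesis using coded_crossword_exists_iff[OF R(2)] R(1) by simp
  qed
  ultimately show ?thesis unfolding many_one_reducible_def by (intro exI[of _ ?f]) simp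
qed

lemma not_computable_halting: "\<not> computable_pred (\<lambda>x. x \<in> yes_instances halting_problem)"
proof
  assume "computable_pred (\<lambda>x. x \<in> yes_instances halting_problem)"
  from computable_pred_comp[OF this total_computable_basic2(3)[OF total_computable_id
        total_computable_list_encode_replicate]]
  have "computable_pred (\<lambda>x. \<not> prod_encode (x, list_encode (replicate x 1)) \<in>
      yes_instances halting_problem)"
    by (rule computable_pred_not)
  then obtain M where M: "\<And>x. halts_on M (replicate x 1) \<longleftrightarrow>
      \<not> prod_encode (x, list_encode (replicate x 1)) \<in> yes_instances halting_problem"
    using semidecidable_imp_halts_on[OF semidecidable_computable_pred] by blast
  let ?e = "tm_code M"
  have "prod_encode (?e, list_encode (replicate ?e 1)) \<in> yes_instances halting_problem \<longleftrightarrow>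
      halts_on M (replicate ?e 1)"
    by (auto simp: halting_problem_def list_encode_eq inj_eq[OF inj_tm_code])
  with M[of ?e] show False by blast
qed

text \<open>All numbers are instances of \<open>halting_problem\<close>, so \<open>f\<close> always
  lands in the instances of \<open>A\<close>, where the procedure \<open>p\<close> is guaranteed to
  answer.\<close>

lemma not_decidable_if_halting_reducible:
  assumes "many_one_reducible halting_problem A"
  shows "\<not> decidable A"
proof
  assume "decidable A"
  then obtain p where p: "\<And>x. x \<in> instances A \<Longrightarrow> computes p [x] (if x \<in> yes_instances A then 1 else 0)"
    unfolding decidable_def by blast
  from assms obtain f where f: "total_computable f" "\<And>x. f x \<in> instances A"
    "\<And>x. x \<in> yes_instances halting_problem \<longleftrightarrow> f x \<in> yes_instances A"
    unfolding many_one_reducible_def by (auto simp: halting_problem_def)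
  from f(1) obtain q where q: "\<And>x. computes q [x] (f x)"
    unfolding total_computable_def by blast
  have "computes (Comp p [q]) [x] (of_bool (x \<in> yes_instances halting_problem))" for x
    using p[OF f(2)[of x]] q[of x] f(3)[of x] by (auto intro!: computes.Comp[of _ _ "[f x]"])
  then have "computable_pred (\<lambda>x. x \<in> yes_instances halting_problem)"
    unfolding computable_pred_def total_computable_def by blast
  with not_computable_halting show False by blast
qed

theorem theorem3p2:
  shows "\<exists>(\<Sigma> :: nat set) (C :: nat rexp).
           finite \<Sigma> \<and> letters C \<subseteq> \<Sigma> \<and> positive C \<and>
           m_equivalent (crossword_problem \<Sigma> C) halting_problem \<and>
           \<not> decidable (crossword_problem \<Sigma> C)"
proof -
  \<comment> \<open>\<open>row_rexp M x\<close> starts the machine on \<open>Suc x\<close> ones, so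
    the machine has to subtract one from the length of its input.\<close>
  have "total_computable (\<lambda>x. x - 1)" by (intro computable_intros)
  from semidecidable_comp[OF semidecidable_halting this] obtain M where
    "\<And>x. halts_on M (replicate x 1) \<longleftrightarrow> x - 1 \<in> yes_instances halting_problem"
    using semidecidable_imp_halts_on by blast
  then have M: "halts_on M (replicate (Suc x) 1) \<longleftrightarrow> x \<in> yes_instances halting_problem" for x
    by (metis diff_Suc_1)
  let ?A = "crossword_problem (alphabet M) (column_rexp M)"
  have "many_one_reducible halting_problem ?A"
    unfolding many_one_reducible_def
    using total_computable_row_rexp[of M] row_rexp_instance[of M] row_rexp_yes_instance_iff[of M] M
    by blast
  then show ?thesis
    using crossword_reducible_to_halting not_decidable_if_halting_reducible
      finite_alphabet letters_column_rexp positive_chain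
    unfolding m_equivalent_def by (metis column_rexp_def)
qed

end
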